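(* Let $p_1,\ldots,p_n\in\mathbb B$ be $n$ distinct points and let $s_1,\ldots,s_n\in\mathbb H$. There exists a function $S\in\mathcal R(\mathbb B,\overline{\mathbb B})$ such that $S(p_i)=s_i$ for $i=1,\ldots,n$ if and only if the Pick matrix $$P=\left[\sum_{k=0}^\infty p_i^k(1-s_i\bar s_j)\bar p_j^k\right]_{i,j=1}^n$$ is positive semidefinite.
   Context: $\mathbb H$ is the algebra of real quaternions, $\mathbb B=\{p\in\mathbb H:|p|<1\}$, $\overline{\mathbb B}$ its closure, and $\mathbb S$ is the unit sphere of purely imaginary quaternions; for $I\in\mathbb S$, $\mathbb C_I=\{x+Iy:x,y\in\mathbb R\}$. For $\Omega\subset\mathbb H$ open, a real differentiable function $f:\Omega\to\mathbb H$ is (left) slice regular on $\Omega$ if for every $I\in\mathbb S$ its restriction $f_I$ to $\Omega\cap\mathbb C_I$ satisfies $\frac{\partial}{\partial x}f_I(x+Iy)+I\frac{\partial}{\partial y}f_I(x+Iy)\equiv0$. The functions slice regular on $\mathbb B$ are exactly the power series $f(p)=\sum_{k\ge0}p^kf_k$, $f_k\in\mathbb H$, with radius of convergence at least one. $\mathcal R(\mathbb B,\overline{\mathbb B})$ is the set of functions $f$ slice regular on $\mathbb B$ with $|f(p)|\le1$ for all $p\in\mathbb B$. Positive semidefiniteness of quaternionic matrices is defined as over $\mathbb C$: a Hermitian matrix $A$ is positive semidefinite if $c^*Ac\ge0$ for all column vectors $c$ over $\mathbb H$. *)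

theory Defs
  imports "HOL-Analysis.Analysis" "HOL-Library.Nonpos_Ints"
begin

section \<open>Quaternions\<close>

datatype quat = Quat (qre: real) (qim1: real) (qim2: real) (qim3: real)

lemma quat_eqI:
  "qre x = qre y \<Longrightarrow> qim1 x = qim1 y \<Longrightarrow> qim2 x = qim2 y \<Longrightarrow> qim3 x = qim3 y \<Longrightarrow> x = y"
  by (cases x; cases y) simp

lemma quat_eq_iff:
  "x = y \<longleftrightarrow> qre x = qre y \<and> qim1 x = qim1 y \<and> qim2 x = qim2 y \<and> qim3 x = qim3 y"
  by (cases x; cases y) simp

definition qcnj :: "quat \<Rightarrow> quat"
  where "qcnj x = Quat (qre x) (- qim1 x) (- qim2 x) (- qim3 x)"

lemma qcnj_sel [simp]:
  "qre (qcnj x) = qre x" "qim1 (qcnj x) = - qim1 x" "qim2 (qcnj x) = - qim2 x" "qim3 (qcnj x) = - qim3 x"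
  by (simp_all add: qcnj_def)

instantiation quat :: ab_group_add
begin
definition "0 = Quat 0 0 0 0"
definition "x + y = Quat (qre x + qre y) (qim1 x + qim1 y) (qim2 x + qim2 y) (qim3 x + qim3 y)"
definition "x - y = Quat (qre x - qre y) (qim1 x - qim1 y) (qim2 x - qim2 y) (qim3 x - qim3 y)"
definition "- x = Quat (- qre x) (- qim1 x) (- qim2 x) (- qim3 x)"
instance
  by standard (simp_all add: zero_quat_def plus_quat_def minus_quat_def uminus_quat_def)
end

lemma quat_add_sel [simp]:
  "qre (x + y) = qre x + qre y" "qim1 (x + y) = qim1 x + qim1 y"
  "qim2 (x + y) = qim2 x + qim2 y" "qim3 (x + y) = qim3 x + qim3 y"
  "qre (x - y) = qre x - qre y" "qim1 (x - y) = qim1 x - qim1 y"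
  "qim2 (x - y) = qim2 x - qim2 y" "qim3 (x - y) = qim3 x - qim3 y"
  "qre (- x) = - qre x" "qim1 (- x) = - qim1 x" "qim2 (- x) = - qim2 x" "qim3 (- x) = - qim3 x"
  "qre 0 = 0" "qim1 0 = 0" "qim2 0 = 0" "qim3 0 = 0"
  by (simp_all add: zero_quat_def plus_quat_def minus_quat_def uminus_quat_def)

instantiation quat :: ring_1
begin
definition "1 = Quat 1 0 0 0"
definition "x * y = Quat
  (qre x * qre y - qim1 x * qim1 y - qim2 x * qim2 y - qim3 x * qim3 y)
  (qre x * qim1 y + qim1 x * qre y + qim2 x * qim3 y - qim3 x * qim2 y)
  (qre x * qim2 y - qim1 x * qim3 y + qim2 x * qre y + qim3 x * qim1 y)
  (qre x * qim3 y + qim1 x * qim2 y - qim2 x * qim1 y + qim3 x * qre y)"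
instance
proof
  fix a b c :: quat
  show "a * b * c = a * (b * c)"
    by (simp add: quat_eq_iff times_quat_def; algebra)
  show "1 * a = a" "a * 1 = a" "(0::quat) \<noteq> 1"
    by (simp_all add: quat_eq_iff one_quat_def times_quat_def)
  show "(a + b) * c = a * c + b * c"
    by (simp add: quat_eq_iff times_quat_def; algebra)
  show "a * (b + c) = a * b + a * c"
    by (simp add: quat_eq_iff times_quat_def; algebra)
qed
end

lemma quat_mult_sel [simp]:
  "qre (x * y) = qre x * qre y - qim1 x * qim1 y - qim2 x * qim2 y - qim3 x * qim3 y"
  "qim1 (x * y) = qre x * qim1 y + qim1 x * qre y + qim2 x * qim3 y - qim3 x * qim2 y"
  "qim2 (x * y) = qre x * qim2 y - qim1 x * qim3 y + qim2 x * qre y + qim3 x * qim1 y"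
  "qim3 (x * y) = qre x * qim3 y + qim1 x * qim2 y - qim2 x * qim1 y + qim3 x * qre y"
  "qre 1 = 1" "qim1 1 = 0" "qim2 1 = 0" "qim3 1 = 0"
  by (simp_all add: one_quat_def times_quat_def)

instantiation quat :: real_algebra_1
begin
definition "r *\<^sub>R x = Quat (r * qre x) (r * qim1 x) (r * qim2 x) (r * qim3 x)"
instance
  by standard (simp_all add: quat_eq_iff scaleR_quat_def algebra_simps)
end

lemma quat_scaleR_sel [simp]:
  "qre (r *\<^sub>R x) = r * qre x" "qim1 (r *\<^sub>R x) = r * qim1 x"
  "qim2 (r *\<^sub>R x) = r * qim2 x" "qim3 (r *\<^sub>R x) = r * qim3 x"
  by (simp_all add: scaleR_quat_def)

instantiation quat :: real_inner
begin
definition "inner x y = qre x * qre y + qim1 x * qim1 y + qim2 x * qim2 y + qim3 x * qim3 y"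
definition "norm (x::quat) = sqrt ((qre x)\<^sup>2 + (qim1 x)\<^sup>2 + (qim2 x)\<^sup>2 + (qim3 x)\<^sup>2)"
definition "sgn (x::quat) = x /\<^sub>R norm x"
definition "dist (x::quat) y = norm (x - y)"
definition [code del]: "(uniformity :: (quat \<times> quat) filter) = (INF e\<in>{0 <..}. principal {(x, y). dist x y < e})"
definition [code del]: "open (U :: quat set) \<longleftrightarrow> (\<forall>x\<in>U. eventually (\<lambda>(x', y). x' = x \<longrightarrow> y \<in> U) uniformity)"
instance
proof
  fix x y z :: quat and r :: real
  show "inner x y = inner y x" "inner (x + y) z = inner x z + inner y z"
    "inner (r *\<^sub>R x) y = r * inner x y" "0 \<le> inner x x" "norm x = sqrt (inner x x)"
    by (simp_all add: inner_quat_def norm_quat_def algebra_simps power2_eq_square)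
  show "inner x x = 0 \<longleftrightarrow> x = 0"
    by (simp add: inner_quat_def quat_eq_iff add_nonneg_eq_0_iff conj_assoc)
qed (simp_all only: sgn_quat_def dist_quat_def uniformity_quat_def open_quat_def)
end

instantiation quat :: real_normed_div_algebra
begin
definition "inverse x = qcnj x /\<^sub>R (norm x)\<^sup>2"
definition "x div y = x * inverse y" for x y :: quat
instance
proof
  fix x y :: quat
  show "x div y = x * inverse y"
    by (simp add: divide_quat_def)
  show "inverse 0 = (0::quat)"
    by (simp add: inverse_quat_def norm_quat_def)
  show "norm (x * y) = norm x * norm y"
    unfolding norm_quat_def real_sqrt_mult [symmetric]
    by (rule arg_cong [of _ _ sqrt]) (simp add: power2_eq_square algebra_simps)
  assume "x \<noteq> 0"
  then have nz: "(norm x)\<^sup>2 \<noteq> 0"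
    by simp
  have N: "(norm x)\<^sup>2 = (qre x)\<^sup>2 + (qim1 x)\<^sup>2 + (qim2 x)\<^sup>2 + (qim3 x)\<^sup>2"
    by (simp add: norm_quat_def)
  have "qcnj x * x = (norm x)\<^sup>2 *\<^sub>R 1" "x * qcnj x = (norm x)\<^sup>2 *\<^sub>R 1"
    unfolding N quat_eq_iff by (simp_all add: power2_eq_square)
  with nz show "inverse x * x = 1" "x * inverse x = 1"
    by (simp_all add: inverse_quat_def)
qed
end

instantiation quat :: euclidean_space
begin
definition "Basis = {Quat 1 0 0 0, Quat 0 1 0 0, Quat 0 0 1 0, Quat 0 0 0 1}"
instance
proof
  show "(Basis :: quat set) \<noteq> {}" "finite (Basis :: quat set)"
    by (simp_all add: Basis_quat_def)
  show "inner u v = (if u = v then 1 else 0)" if "u \<in> Basis" "v \<in> Basis" for u v :: quat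
    using that unfolding Basis_quat_def by (elim insertE emptyE) (simp_all add: inner_quat_def)
  show "(\<forall>u\<in>Basis. inner x u = 0) \<longleftrightarrow> x = 0" for x :: quat
    by (cases x) (simp add: Basis_quat_def inner_quat_def zero_quat_def)
qed
end

definition unit_imag_quats :: "quat set"
  where "unit_imag_quats = {I. qre I = 0 \<and> norm I = 1}"

section \<open>Slice regular functions\<close>

definition slice_regular_on :: "quat set \<Rightarrow> (quat \<Rightarrow> quat) \<Rightarrow> bool"
  where "slice_regular_on \<Omega> f \<longleftrightarrow>
    open \<Omega> \<and> f differentiable_on \<Omega> \<and>
    (\<forall>I\<in>unit_imag_quats. \<forall>x y :: real. of_real x + I * of_real y \<in> \<Omega> \<longrightarrow>
       vector_derivative (\<lambda>t. f (of_real t + I * of_real y)) (at x)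
       + I * vector_derivative (\<lambda>t. f (of_real x + I * of_real t)) (at y) = 0)"

definition slice_schur_class :: "(quat \<Rightarrow> quat) set"
  where "slice_schur_class =
    {S. slice_regular_on (ball 0 1) S \<and> (\<forall>p\<in>ball 0 1. norm (S p) \<le> 1)}"

section \<open>Positive semidefinite quaternionic matrices and the Pick matrix\<close>

definition quat_hermitian :: "quat ^ 'n ^ 'n \<Rightarrow> bool"
  where "quat_hermitian A \<longleftrightarrow> (\<forall>i j. A $ j $ i = qcnj (A $ i $ j))"

definition quat_psd :: "quat ^ 'n ^ 'n \<Rightarrow> bool"
  where "quat_psd A \<longleftrightarrow> quat_hermitian A \<and>
    (\<forall>c :: quat ^ 'n. (\<Sum>i\<in>UNIV. qcnj (c $ i) * (A *v c) $ i) \<in> \<real>\<^sub>\<ge>\<^sub>0)"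

text \<open>The series converges (absolutely) whenever all \<open>p $ i\<close> lie in the open unit ball.\<close>

definition pick_matrix :: "quat ^ 'n \<Rightarrow> quat ^ 'n \<Rightarrow> quat ^ 'n ^ 'n"
  where "pick_matrix p s =
    (\<chi> i j. \<Sum>k. p $ i ^ k * (1 - s $ i * qcnj (s $ j)) * qcnj (p $ j) ^ k)"

end

theory Submission
  imports Defs "HOL-Complex_Analysis.Cauchy_Integral_Formula"
begin

text \<open>
  Both directions rest on the identification of slice regular functions on the unit ball with power
  series \<open>S p = (\<Sum>k. p ^ k * c k)\<close> (lemmas \<open>slice_regular_imp_power_series\<close> and
  \<open>power_series_slice_regular\<close>).

  If \<open>S\<close> is bounded by \<open>1\<close>, the adjoint of multiplication by \<open>S\<close> is a contraction on
  square-summable coefficient sequences (\<open>schur_adjoint_contraction\<close>). The sequences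
  \<open>k \<mapsto> qcnj (p i) ^ k\<close> are eigenvectors of that adjoint, with \<open>qcnj (s i)\<close> as eigenvalue, multiplying from
  the left. So the form of the Pick matrix is the square norm of a combination of these sequences minus the
  square norm of its image, hence nonnegative. Contractivity is not immediate from the pointwise bound, since
  multiplication of quaternionic power series is not pointwise. On finite sequences, read backwards, the
  adjoint is convolution with the conjugated coefficients, whose symbol is bounded by \<open>1\<close> as well. A finitely supported sequence with
  transform \<open>x\<close> on a complex circle is mapped to one whose transform is the symbol, evaluated at the rotated point
  \<open>x * v * inverse x\<close>, times \<open>x\<close> (\<open>polynomial_toeplitz_bound\<close>). The bound
  on the symbol holds at rotated points too, so the discrete Parseval identity gives the norm bound.

  Conversely, a positive semidefinite Pick matrix is the Gram matrix of vectors \<open>b i\<close>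
  (\<open>quat_psd_gram\<close>). The Stein equation \<open>P i j + s i * qcnj (s j) = p i * P i j * qcnj (p j) + 1\<close> makes
  \<open>(p i * b i, 1) \<mapsto> (b i, s i)\<close> an isometry. It extends to a contraction commuting
  with left scalars (\<open>equivariant_contraction_extension\<close>), and the transfer function of this contraction is a
  slice regular function bounded by \<open>1\<close> that interpolates (\<open>contractive_colligation_schur\<close>). Left
  linearity is what keeps the powers of \<open>p\<close> on the left of the coefficients.
\<close>

section \<open>Quaternion algebra\<close>

lemma qcnj_simps [simp]:
  "qcnj (x + y) = qcnj x + qcnj y" "qcnj (x - y) = qcnj x - qcnj y" "qcnj (x * y) = qcnj y * qcnj x"
  "qcnj (r *\<^sub>R x) = r *\<^sub>R qcnj x" "qcnj (- x) = - qcnj x" "qcnj 0 = 0" "qcnj 1 = 1" "qcnj (qcnj x) = x" "norm (qcnj x) = norm x"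
  by (simp_all add: quat_eq_iff norm_quat_def)

lemma qcnj_power [simp]: "qcnj (x ^ k) = qcnj x ^ k"
  by (induction k) (simp_all add: power_commutes)

lemma qcnj_sum: "qcnj (sum f A) = (\<Sum>i\<in>A. qcnj (f i))"
  by (induction A rule: infinite_finite_induct) simp_all

lemma quat_of_real_sel [simp]:
  "qre (of_real r) = r" "qim1 (of_real r) = 0" "qim2 (of_real r) = 0" "qim3 (of_real r) = 0"
  by (simp_all add: of_real_def)

lemma of_real_commute_quat: "of_real r * (x :: quat) = x * of_real r"
  by (simp add: quat_eq_iff)

lemma norm_quat_squared: "(norm (x::quat))\<^sup>2 = (qre x)\<^sup>2 + (qim1 x)\<^sup>2 + (qim2 x)\<^sup>2 + (qim3 x)\<^sup>2"
  by (simp add: norm_quat_def)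

lemma qcnj_mult_self: "qcnj x * x = of_real ((norm x)\<^sup>2)" "x * qcnj x = of_real ((norm x)\<^sup>2)"
  unfolding quat_eq_iff norm_quat_squared by (simp_all add: power2_eq_square)

lemma inner_quat_eq: "inner x y = qre (x * qcnj y)"
  by (simp add: inner_quat_def)

lemma inner_mult_left_quat: "inner (a * x) y = inner x (qcnj a * (y::quat))"
  by (simp add: inner_quat_def algebra_simps)

lemma bounded_linear_qcnj: "bounded_linear qcnj"
  by (rule bounded_linear_intro [where K = 1]) (simp_all add: quat_eq_iff)

lemma bounded_linear_qre: "bounded_linear qre"
proof (rule bounded_linear_intro [where K = 1])
  show "norm (qre x) \<le> norm x * 1" for x
    unfolding norm_quat_def using real_sqrt_le_mono[of "(qre x)\<^sup>2" "(qre x)\<^sup>2 + (qim1 x)\<^sup>2 + (qim2 x)\<^sup>2 + (qim3 x)\<^sup>2"]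
    by simp
qed simp_all

section \<open>Power series are slice regular\<close>

text \<open>The derivative of the power function in a noncommutative algebra is
\<open>h \<mapsto> \<Sum>j<k. p ^ j * h * p ^ (k - 1 - j)\<close>; the recursion is the product rule applied to
\<open>p * p ^ k\<close>.\<close>

primrec power_deriv :: "nat \<Rightarrow> 'a::real_normed_algebra_1 \<Rightarrow> 'a \<Rightarrow> 'a" where
  "power_deriv 0 p h = 0"
| "power_deriv (Suc k) p h = p * power_deriv k p h + h * p ^ k"

lemma has_derivative_power_deriv:
  "((\<lambda>p. p ^ k) has_derivative power_deriv k p) (at p within S)"
proof (induction k)
  case (Suc k)
  have "((\<lambda>p. p * p ^ k) has_derivative (\<lambda>h. p * power_deriv k p h + h * p ^ k)) (at p within S)"
    by (rule has_derivative_mult [OF has_derivative_ident Suc])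
  moreover have "power_deriv (Suc k) p = (\<lambda>h. p * power_deriv k p h + h * p ^ k)"
    by (simp add: fun_eq_iff)
  ultimately show ?case by simp
next
  case 0
  have "power_deriv 0 p = (\<lambda>h. 0)" by (simp add: fun_eq_iff)
  then show ?case by simp
qed

lemma norm_power_deriv_Suc:
  assumes "norm p \<le> r"
  shows "norm (power_deriv (Suc k) p h) \<le> real (Suc k) * r ^ k * norm h"
proof (induction k)
  case (Suc k)
  have r: "0 \<le> r" using assms norm_ge_zero order_trans by blast
  have "norm (power_deriv (Suc (Suc k)) p h)
      \<le> norm (p * power_deriv (Suc k) p h) + norm (h * p ^ Suc k)"
    by (metis power_deriv.simps(2) norm_triangle_ineq)
  also have "\<dots> \<le> norm p * norm (power_deriv (Suc k) p h) + norm h * norm p ^ Suc k"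
    by (intro add_mono norm_mult_ineq order_trans[OF norm_mult_ineq] mult_left_mono norm_power_ineq) auto
  also have "\<dots> \<le> r * (real (Suc k) * r ^ k * norm h) + norm h * r ^ Suc k"
    using assms r by (intro add_mono mult_mono Suc power_mono) auto
  finally show ?case by (simp add: algebra_simps)
qed simp

text \<open>Along the slice containing \<open>p\<close> the variable commutes with the increment, so the derivative
of a power is linear over that slice; this is what makes each power slice regular.\<close>

lemma power_deriv_commute:
  assumes "p * h = h * p"
  shows "power_deriv k p h = h * power_deriv k p 1"
proof (induction k)
  case (Suc k)
  have "power_deriv (Suc k) p h = (p * h) * power_deriv k p 1 + h * p ^ k"
    by (simp add: Suc mult.assoc)
  then show ?case unfolding assms by (simp add: mult.assoc distrib_left)
qed simp

text \<open>Term-by-term differentiation: on a ball of radius \<open>r < 1\<close> the derivatives of the terms are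
dominated in operator norm by the terms of the formally differentiated real series.\<close>

lemma power_series_has_derivative:
  fixes c :: "nat \<Rightarrow> quat"
  assumes sc: "\<And>r. 0 \<le> r \<Longrightarrow> r < 1 \<Longrightarrow> summable (\<lambda>k. norm (c k) * r ^ k)"
    and "norm p < 1"
  shows "summable (\<lambda>k. power_deriv k p h * c k)"
    and "((\<lambda>p. \<Sum>k. p ^ k * c k) has_derivative (\<lambda>h. \<Sum>k. power_deriv k p h * c k)) (at p)"
proof -
  obtain r where r: "norm p < r" "r < 1" using assms(2) dense by blast
  have r0: "0 \<le> r" using r norm_ge_zero[of p] by linarith
  define M where "M k = real k * r ^ (k - 1) * norm (c k)" for k
  have "summable (\<lambda>k. diffs (\<lambda>k. norm (c k)) k * r ^ k)"
  proof (rule termdiff_converges [where K = 1])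
    show "summable (\<lambda>k. norm (c k) * x ^ k)" if "norm x < 1" for x :: real
      by (rule summable_comparison_test'[OF sc[of "\<bar>x\<bar>"]]) (use that in \<open>auto simp: abs_mult power_abs\<close>)
  qed (use r r0 in auto)
  then have "summable (\<lambda>k. M (Suc k))"
    by (simp add: M_def diffs_def mult_ac)
  then have M: "summable M" by (simp only: summable_Suc_iff)
  have bd: "norm (power_deriv k x h * c k) \<le> M k * norm h" if "norm x \<le> r" for k x h
    using mult_right_mono[OF norm_power_deriv_Suc[OF that, of "k - 1" h], of "norm (c k)"]
    by (cases k) (simp_all add: M_def norm_mult mult_ac)
  have su: "summable (\<lambda>k. norm (power_deriv k x h * c k))" if "norm x \<le> r" for x h
    by (rule summable_comparison_test'[OF summable_mult2[OF M]]) (use bd[OF that] in simp)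
  show "summable (\<lambda>k. power_deriv k p h * c k)"
    by (rule summable_norm_cancel, rule su) (use r in simp)
  have sf: "summable (\<lambda>k. x ^ k * c k)" if "norm x < 1" for x
    by (rule summable_norm_cancel, rule summable_comparison_test'[OF sc[of "norm x"]])
       (use that in \<open>auto simp: norm_mult norm_power\<close>)
  have "\<exists>g. \<forall>x\<in>ball 0 r. (\<lambda>k. x ^ k * c k) sums g x \<and>
      (g has_derivative (\<lambda>h. \<Sum>k. power_deriv k x h * c k)) (at x within ball 0 r)"
  proof (rule has_derivative_series)
    show "((\<lambda>x. x ^ n * c n) has_derivative (\<lambda>h. power_deriv n x h * c n)) (at x within ball 0 r)" for n x
      by (rule has_derivative_mult_left[OF has_derivative_power_deriv])
    show "(\<lambda>k. 0 ^ k * c k) sums (\<Sum>k. 0 ^ k * c k)"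
      by (rule summable_sums[OF sf]) simp
    show "(0::quat) \<in> ball 0 r" using le_less_trans[OF norm_ge_zero r(1)] by simp
    fix e :: real assume "e > 0"
    have "\<forall>\<^sub>F n in sequentially. norm (\<Sum>k. M (k + n)) < e"
      using suminf_exist_split[OF \<open>e > 0\<close> M] by (auto simp: eventually_sequentially)
    then show "\<forall>\<^sub>F n in sequentially. \<forall>x\<in>ball 0 r. \<forall>h.
      norm ((\<Sum>k<n. power_deriv k x h * c k) - (\<Sum>k. power_deriv k x h * c k)) \<le> e * norm h"
    proof eventually_elim
      case (elim n)
      show ?case
      proof (intro ballI allI)
        fix x h :: quat assume "x \<in> ball 0 r"
        then have x: "norm x \<le> r" by simp
        let ?D = "\<lambda>k. power_deriv k x h * c k"
        have Mn: "summable (\<lambda>k. M (k + n))" using M by (simp add: summable_iff_shift)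
        have "norm ((\<Sum>k<n. ?D k) - (\<Sum>k. ?D k)) = norm (\<Sum>k. ?D (k + n))"
          using suminf_split_initial_segment[OF summable_norm_cancel[OF su[OF x]], of h n]
          by (simp add: norm_minus_commute)
        also have "\<dots> \<le> (\<Sum>k. M (k + n) * norm h)"
        proof -
          have s: "summable (\<lambda>k. norm (?D (k + n)))" by (rule summable_ignore_initial_segment[OF su[OF x]])
          show ?thesis
            by (rule order_trans[OF summable_norm[OF s] suminf_le[OF bd[OF x] s summable_mult2[OF Mn]]])
        qed
        also have "\<dots> = (\<Sum>k. M (k + n)) * norm h" by (rule suminf_mult2[OF Mn, symmetric])
        also have "\<dots> \<le> e * norm h" using elim by (intro mult_right_mono) auto
        finally show "norm ((\<Sum>k<n. ?D k) - (\<Sum>k. ?D k)) \<le> e * norm h" .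
      qed
    qed
  qed simp
  then obtain g where g: "\<And>x. x \<in> ball 0 r \<Longrightarrow> (\<lambda>k. x ^ k * c k) sums g x"
    "\<And>x. x \<in> ball 0 r \<Longrightarrow> (g has_derivative (\<lambda>h. \<Sum>k. power_deriv k x h * c k)) (at x within ball 0 r)"
    by blast
  have p: "p \<in> ball 0 r" using r by simp
  have "(g has_derivative (\<lambda>h. \<Sum>k. power_deriv k p h * c k)) (at p)"
    using g(2)[OF p] at_within_open[OF p open_ball] by simp
  then show "((\<lambda>p. \<Sum>k. p ^ k * c k) has_derivative (\<lambda>h. \<Sum>k. power_deriv k p h * c k)) (at p)"
    by (rule has_derivative_transform_within_open[OF _ open_ball p]) (rule sums_unique[OF g(1)])
qed

lemma unit_imag_square:
  assumes "I \<in> unit_imag_quats"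
  shows "I * I = - 1"
proof -
  have "qre I = 0" "(qim1 I)\<^sup>2 + (qim2 I)\<^sup>2 + (qim3 I)\<^sup>2 = 1"
    using assms norm_quat_squared[of I] by (auto simp: unit_imag_quats_def)
  then show ?thesis by (simp add: quat_eq_iff power2_eq_square)
qed

text \<open>Turns the two partial derivatives in the definition of slice regularity into values of the total
derivative, so that the Cauchy--Riemann equation becomes \<open>f' 1 + I * f' I = 0\<close>.\<close>

lemma slice_partial_derivatives:
  fixes f :: "quat \<Rightarrow> 'b::real_normed_vector"
  assumes f: "(f has_derivative f') (at (of_real x + I * of_real y))"
  shows "vector_derivative (\<lambda>t. f (of_real t + I * of_real y)) (at x) = f' 1"
    and "vector_derivative (\<lambda>t. f (of_real x + I * of_real t)) (at y) = f' I"
proof -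
  have chain: "vector_derivative (\<lambda>t. f (g t)) (at t) = f' v"
    if "(g has_vector_derivative v) (at t)" "g t = of_real x + I * of_real y" for g :: "real \<Rightarrow> quat" and t v
  proof (rule vector_derivative_at)
    have "(f has_derivative f') (at (g t) within range g)"
      using f that(2) by (simp add: has_derivative_at_withinI)
    from vector_derivative_diff_chain_within[OF that(1) this]
    show "((\<lambda>t. f (g t)) has_vector_derivative f' v) (at t)" by (simp add: o_def)
  qed
  show "vector_derivative (\<lambda>t. f (of_real t + I * of_real y)) (at x) = f' 1"
    by (rule chain) (auto simp: of_real_def has_vector_derivative_def intro!: derivative_eq_intros)
  show "vector_derivative (\<lambda>t. f (of_real x + I * of_real t)) (at y) = f' I"
    by (rule chain) (auto simp: of_real_def has_vector_derivative_def intro!: derivative_eq_intros)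
qed

lemma power_series_slice_regular:
  fixes c :: "nat \<Rightarrow> quat"
  assumes sc: "\<And>r. 0 \<le> r \<Longrightarrow> r < 1 \<Longrightarrow> summable (\<lambda>k. norm (c k) * r ^ k)"
  shows "slice_regular_on (ball 0 1) (\<lambda>p. \<Sum>k. p ^ k * c k)"
  unfolding slice_regular_on_def
proof (intro conjI ballI allI impI)
  show "(\<lambda>p. \<Sum>k. p ^ k * c k) differentiable_on ball 0 1"
    unfolding differentiable_on_def
  proof
    fix p :: quat assume "p \<in> ball 0 1"
    then have "norm p < 1" by simp
    from power_series_has_derivative(2)[OF sc this]
    have "(\<lambda>p. \<Sum>k. p ^ k * c k) differentiable (at p)"
      unfolding differentiable_def by blast
    then show "(\<lambda>p. \<Sum>k. p ^ k * c k) differentiable (at p within ball 0 1)"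
      by (rule differentiable_at_withinI)
  qed
  fix I :: quat and x y :: real
  assume I: "I \<in> unit_imag_quats" and "of_real x + I * of_real y \<in> ball 0 1"
  define p where "p = of_real x + I * of_real y"
  let ?f = "\<lambda>p. \<Sum>k. p ^ k * c k"
  define f' where "f' h = (\<Sum>k. power_deriv k p h * c k)" for h
  have p: "norm p < 1" using \<open>of_real x + I * of_real y \<in> _\<close> by (simp add: p_def)
  have f': "(?f has_derivative f') (at p)"
    unfolding f'_def by (rule power_series_has_derivative(2)[OF sc p])
  have pI: "p * I = I * p" by (simp add: p_def quat_eq_iff algebra_simps)
  have "vector_derivative (\<lambda>t. ?f (of_real t + I * of_real y)) (at x) = f' 1"
    "vector_derivative (\<lambda>t. ?f (of_real x + I * of_real t)) (at y) = f' I"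
    by (rule slice_partial_derivatives[OF f'[unfolded p_def]])+
  moreover have "f' I = I * f' 1"
    unfolding f'_def power_deriv_commute[OF pI] mult.assoc
    by (rule suminf_mult[OF power_series_has_derivative(1)[OF sc p]])
  ultimately show "vector_derivative (\<lambda>t. ?f (of_real t + I * of_real y)) (at x)
       + I * vector_derivative (\<lambda>t. ?f (of_real x + I * of_real t)) (at y) = 0"
    using unit_imag_square[OF I] by (simp add: mult.assoc[symmetric])
qed simp

section \<open>Slice regular functions are power series\<close>

definition quat_of_complex :: "complex \<Rightarrow> quat" where
  "quat_of_complex z = Quat (Re z) (Im z) 0 0"

lemma quat_of_complex_sel [simp]:
  "qre (quat_of_complex z) = Re z" "qim1 (quat_of_complex z) = Im z"
  "qim2 (quat_of_complex z) = 0" "qim3 (quat_of_complex z) = 0"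
  by (simp_all add: quat_of_complex_def)

lemma quat_of_complex_simps [simp]:
  "quat_of_complex (z + w) = quat_of_complex z + quat_of_complex w"
  "quat_of_complex (z * w) = quat_of_complex z * quat_of_complex w"
  "quat_of_complex 0 = 0" "quat_of_complex 1 = 1" "norm (quat_of_complex z) = norm z"
  "qcnj (quat_of_complex z) = quat_of_complex (cnj z)"
  by (simp_all add: quat_eq_iff norm_quat_def cmod_def)

lemma quat_of_complex_power: "quat_of_complex (z ^ k) = quat_of_complex z ^ k"
  by (induction k) simp_all

lemma quat_of_complex_sum: "quat_of_complex (sum f A) = (\<Sum>i\<in>A. quat_of_complex (f i))"
  by (induction A rule: infinite_finite_induct) simp_all

lemma bounded_linear_quat_of_complex: "bounded_linear quat_of_complex"
  by (rule bounded_linear_intro[where K = 1]) (simp_all add: quat_eq_iff)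

text \<open>All slices are conjugate: a solution of \<open>I * u = u * \<i>\<close> makes \<open>z \<mapsto> u * z * inverse u\<close> a
rotation taking the standard complex plane to the slice of \<open>I\<close>. The witness \<open>I + \<i>\<close> works by
expanding both sides, except when it vanishes; then \<open>j\<close> does, because it anticommutes with \<open>\<i>\<close>.\<close>

lemma unit_imag_rotation:
  assumes "I \<in> unit_imag_quats"
  obtains u where "u \<noteq> 0" "I * u = u * quat_of_complex \<i>"
proof (cases "I = - quat_of_complex \<i>")
  case True
  show thesis
    by (rule that[of "Quat 0 0 1 0"]) (simp_all add: True quat_eq_iff)
next
  case False
  show thesis
  proof (rule that)
    show "I + quat_of_complex \<i> \<noteq> 0" using False by (simp add: eq_neg_iff_add_eq_0)
    have "quat_of_complex \<i> * quat_of_complex \<i> = - 1" by (simp add: quat_eq_iff)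
    then show "I * (I + quat_of_complex \<i>) = (I + quat_of_complex \<i>) * quat_of_complex \<i>"
      using unit_imag_square[OF assms] by (simp add: distrib_left distrib_right)
  qed
qed

text \<open>After rotating the slice to the standard complex plane and multiplying by \<open>inverse u\<close> on the left,
the Cauchy--Riemann equation involves left multiplication by \<open>\<i>\<close> only. Writing quaternions as
\<open>F + G * j\<close> with complex \<open>F\<close> and \<open>G\<close> then splits the function into two ordinary holomorphic
functions on the disc, whose Taylor series are reassembled and rotated back.\<close>

lemma slice_regular_imp_power_series_on_slice:
  assumes f: "slice_regular_on (ball 0 1) f" and I: "I \<in> unit_imag_quats"
  obtains c where "\<And>x y. norm (of_real x + I * of_real y) < 1 \<Longrightarrow>
    (\<lambda>k. (of_real x + I * of_real y) ^ k * c k) sums f (of_real x + I * of_real y)"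
proof -
  obtain u where u: "u \<noteq> 0" "I * u = u * quat_of_complex \<i>" using unit_imag_rotation[OF I] .
  define e where "e z = of_real (Re z) + I * of_real (Im z)" for z :: complex
  have eu: "e z * u = u * quat_of_complex z" for z
  proof -
    have "e z * u = Re z *\<^sub>R u + Im z *\<^sub>R (I * u)" by (simp add: e_def of_real_def distrib_right)
    also have "\<dots> = u * (of_real (Re z) + quat_of_complex \<i> * of_real (Im z))"
      by (simp add: u(2) of_real_def distrib_left mult.assoc)
    also have "of_real (Re z) + quat_of_complex \<i> * of_real (Im z) = quat_of_complex z"
      by (simp add: quat_eq_iff)
    finally show ?thesis .
  qed
  then have e: "e z = u * quat_of_complex z * inverse u" for z
    using u(1) by (metis mult.assoc right_inverse mult.right_neutral)
  have norme: "norm (e z) = norm z" for z using u(1) by (simp add: e norm_mult norm_inverse)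
  have e1: "e (of_real t + \<i> * of_real y) = of_real t + I * of_real y" for t y by (simp add: e_def)
  define w where "w z = inverse u * f (e z)" for z
  define j where "j = Quat 0 0 1 0"
  define F where "F z = Complex (qre (w z)) (qim1 (w z))" for z
  define G where "G z = Complex (qim2 (w z)) (qim3 (w z))" for z
  have wFG: "w z = quat_of_complex (F z) + quat_of_complex (G z) * j" for z
    by (simp add: quat_eq_iff F_def G_def j_def)
  have "\<exists>F' G'. (F has_field_derivative F') (at z) \<and> (G has_field_derivative G') (at z)"
    if z: "z \<in> ball 0 1" for z
  proof -
    have ez: "e z \<in> ball 0 1" using z norme by simp
    have ble: "bounded_linear e"
      by (rule linear_conv_bounded_linear[THEN iffD1], rule linearI)
         (simp_all add: e_def of_real_def distrib_left scaleR_add_left scaleR_add_right)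
    have "f differentiable (at (e z))"
      using f ez at_within_open[OF ez open_ball] unfolding slice_regular_on_def differentiable_on_def by metis
    then obtain f' where f': "(f has_derivative f') (at (e z))" unfolding differentiable_def by blast
    interpret f': bounded_linear f' using f' by (rule has_derivative_bounded_linear)
    note partials = slice_partial_derivatives[OF f'[unfolded e_def]]
    have CR: "f' 1 + I * f' I = 0"
      using f I ez partials unfolding slice_regular_on_def e_def by metis
    have CR': "f' I = I * f' 1"
    proof -
      have "I * (f' 1 + I * f' I) = I * f' 1 - f' I"
        using unit_imag_square[OF I] by (simp add: distrib_left mult.assoc[symmetric])
      then show ?thesis using CR by simp
    qed
    define v where "v = inverse u * f' 1"
    have "inverse u * f' (e h) = quat_of_complex h * v" for h
    proof -
      have "f' (e h) = f' (Re h *\<^sub>R 1) + f' (Im h *\<^sub>R I)"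
        by (simp add: e_def of_real_def f'.add)
      also have "\<dots> = e h * f' 1"
        unfolding f'.scaleR CR' by (simp add: e_def of_real_def distrib_right)
      finally show ?thesis using u(1) by (simp add: e v_def mult.assoc[symmetric])
    qed
    moreover have "((\<lambda>z. inverse u * f (e z)) has_derivative (\<lambda>h. inverse u * f' (e h))) (at z)"
      by (rule has_derivative_mult_right, rule has_derivative_compose[OF bounded_linear_imp_has_derivative[OF ble]], rule f')
    ultimately have w': "(w has_derivative (\<lambda>h. quat_of_complex h * v)) (at z)"
      by (simp add: w_def[abs_def])
    have blF: "bounded_linear (\<lambda>q. Complex (qre q) (qim1 q))"
      and blG: "bounded_linear (\<lambda>q. Complex (qim2 q) (qim3 q))"
      by (rule linear_conv_bounded_linear[THEN iffD1], rule linearI, simp_all add: complex_eq_iff)+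
    have "(F has_derivative (\<lambda>h. Complex (qre v) (qim1 v) * h)) (at z)"
    proof -
      have "(\<lambda>h. Complex (qre (quat_of_complex h * v)) (qim1 (quat_of_complex h * v))) = (\<lambda>h. Complex (qre v) (qim1 v) * h)"
        by (simp add: fun_eq_iff complex_eq_iff algebra_simps)
      then show ?thesis
        using bounded_linear.has_derivative[OF blF w'] by (simp only: F_def[abs_def])
    qed
    moreover have "(G has_derivative (\<lambda>h. Complex (qim2 v) (qim3 v) * h)) (at z)"
    proof -
      have "(\<lambda>h. Complex (qim2 (quat_of_complex h * v)) (qim3 (quat_of_complex h * v))) = (\<lambda>h. Complex (qim2 v) (qim3 v) * h)"
        by (simp add: fun_eq_iff complex_eq_iff algebra_simps)
      then show ?thesis
        using bounded_linear.has_derivative[OF blG w'] by (simp only: G_def[abs_def])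
    qed
    ultimately show ?thesis unfolding has_field_derivative_def by blast
  qed
  then have holF: "F holomorphic_on ball 0 1" and holG: "G holomorphic_on ball 0 1"
    by (meson holomorphic_on_open open_ball)+
  define a where "a k = (deriv ^^ k) F 0 / fact k" for k
  define b where "b k = (deriv ^^ k) G 0 / fact k" for k
  define c where "c k = u * (quat_of_complex (a k) + quat_of_complex (b k) * j)" for k
  have "(\<lambda>k. e z ^ k * c k) sums f (e z)" if z: "norm z < 1" for z
  proof -
    have "(\<lambda>k. a k * z ^ k) sums F z" "(\<lambda>k. b k * z ^ k) sums G z"
      using holomorphic_power_series[OF holF, of z] holomorphic_power_series[OF holG, of z] z
      by (simp_all add: a_def b_def)
    note s = this[THEN bounded_linear.sums[OF bounded_linear_quat_of_complex]]
    have "(\<lambda>k. u * (quat_of_complex (a k * z ^ k) + quat_of_complex (b k * z ^ k) * j)) sums (u * w z)"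
      unfolding wFG by (intro sums_mult sums_add sums_mult2 s)
    moreover have "u * w z = f (e z)" using u(1) by (simp add: w_def mult.assoc[symmetric])
    moreover have "e z ^ k * c k = u * (quat_of_complex (a k * z ^ k) + quat_of_complex (b k * z ^ k) * j)" for k
    proof -
      have "e z ^ k * u = u * quat_of_complex z ^ k"
      proof (induction k)
        case (Suc k)
        have "e z ^ Suc k * u = e z * (e z ^ k * u)" by (simp add: mult.assoc)
        also have "\<dots> = (e z * u) * quat_of_complex z ^ k" by (simp add: Suc mult.assoc)
        finally show ?case by (simp add: eu mult.assoc)
      qed simp
      then have "e z ^ k * c k = u * (quat_of_complex (z ^ k) * (quat_of_complex (a k) + quat_of_complex (b k) * j))"
        by (simp add: c_def mult.assoc[symmetric] quat_of_complex_power)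
      also have "\<dots> = u * (quat_of_complex (z ^ k * a k) + quat_of_complex (z ^ k * b k) * j)"
        by (simp add: distrib_left mult.assoc)
      finally show ?thesis by (simp only: mult.commute)
    qed
    ultimately show ?thesis by simp
  qed
  then have "(\<lambda>k. (of_real x + I * of_real y) ^ k * c k) sums f (of_real x + I * of_real y)"
    if "norm (of_real x + I * of_real y) < 1" for x y
    using that norme[of "of_real x + \<i> * of_real y"] unfolding e1[symmetric] by simp
  then show thesis by (rule that)
qed

lemma real_power_series_zero:
  fixes a :: "nat \<Rightarrow> real"
  assumes "\<And>x. \<bar>x\<bar> < 1 \<Longrightarrow> (\<lambda>k. a k * x ^ k) sums 0"
  shows "a k = 0"
proof (rule ccontr)
  assume nz: "a k \<noteq> 0"
  have "a 0 = 0"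
    using sums_unique2[OF assms[of 0] powser_sums_zero[of a]] by simp
  then have "k > 0" using nz by (cases k) auto
  show False
  proof (rule powser_0_nonzero[where r = 1 and \<xi> = 0 and f = "\<lambda>_. 0" and a = a and m = k])
    show "(\<lambda>n. a n * (x - 0) ^ n) sums 0" if "norm (x - 0) < 1" for x
      using assms that by simp
    fix s :: real assume "0 < s" and s: "\<And>z::real. z \<in> cball 0 s - {0} \<Longrightarrow> (0::real) \<noteq> 0"
    then have "s \<in> cball 0 s - {0}" by simp
    then show False using s by blast
  qed (use nz \<open>k > 0\<close> in auto)
qed

lemma quat_power_series_unique:
  assumes "\<And>x. \<bar>x\<bar> < 1 \<Longrightarrow> (\<lambda>k. of_real x ^ k * c k) sums l x"
    and "\<And>x. \<bar>x\<bar> < 1 \<Longrightarrow> (\<lambda>k. of_real x ^ k * d k) sums (l x :: quat)"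
  shows "c = d"
proof
  fix k
  have "inner (c k - d k) e = 0" for e
  proof (rule real_power_series_zero)
    fix x :: real assume "\<bar>x\<bar> < 1"
    from sums_diff[OF assms(1)[OF this] assms(2)[OF this]]
    have "(\<lambda>k. x ^ k *\<^sub>R (c k - d k)) sums 0"
      by (simp add: scaleR_conv_of_real algebra_simps)
    from bounded_linear.sums[OF bounded_linear_inner_left this, of e]
    show "(\<lambda>k. inner (c k - d k) e * x ^ k) sums 0" by (simp add: mult.commute)
  qed
  then have "inner (c k - d k) (c k - d k) = 0" by blast
  then show "c k = d k" by simp
qed

lemma quat_slice_decomposition:
  obtains I x y where "I \<in> unit_imag_quats" "p = of_real x + I * of_real y"
proof (cases "p = of_real (qre p)")
  case True
  show thesis
    by (rule that[of "Quat 0 1 0 0" "qre p" 0]) (use True in \<open>auto simp: unit_imag_quats_def norm_quat_def\<close>)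
next
  case False
  define v where "v = p - of_real (qre p)"
  have v: "v \<noteq> 0" "qre v = 0" using False by (simp_all add: v_def)
  show thesis
  proof (rule that)
    show "v /\<^sub>R norm v \<in> unit_imag_quats" using v by (simp add: unit_imag_quats_def)
    show "p = of_real (qre p) + v /\<^sub>R norm v * of_real (norm v)"
      using v by (simp add: of_real_def) (simp add: v_def of_real_def)
  qed
qed

text \<open>The expansions on different slices have the same coefficients, because all slices share the real
interval, which already determines them.\<close>

lemma slice_regular_imp_power_series:
  assumes f: "slice_regular_on (ball 0 1) f"
  obtains c where "\<And>p. norm p < 1 \<Longrightarrow> (\<lambda>k. p ^ k * c k) sums f p"
proof -
  have ex: "\<exists>c. \<forall>x y. norm (of_real x + I * of_real y) < 1 \<longrightarrow>
    (\<lambda>k. (of_real x + I * of_real y) ^ k * c k) sums f (of_real x + I * of_real y)"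
    if "I \<in> unit_imag_quats" for I
    using slice_regular_imp_power_series_on_slice[OF f that] by metis
  then obtain c where c: "\<And>I x y. I \<in> unit_imag_quats \<Longrightarrow> norm (of_real x + I * of_real y) < 1 \<Longrightarrow>
    (\<lambda>k. (of_real x + I * of_real y) ^ k * c I k) sums f (of_real x + I * of_real y)"
    by metis
  have same: "c I = c J" if "I \<in> unit_imag_quats" "J \<in> unit_imag_quats" for I J
  proof (rule quat_power_series_unique)
    show "(\<lambda>k. of_real x ^ k * c I k) sums f (of_real x)" "(\<lambda>k. of_real x ^ k * c J k) sums f (of_real x)"
      if "\<bar>x\<bar> < 1" for x
      using c[of I x 0] c[of J x 0] \<open>I \<in> _\<close> \<open>J \<in> _\<close> that by simp_all
  qed
  \<comment> \<open>Any fixed slice can supply the coefficients.\<close>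
  define J where "J = Quat 0 1 0 0"
  have J: "J \<in> unit_imag_quats" by (simp add: J_def unit_imag_quats_def norm_quat_def)
  show thesis
  proof
    fix p :: quat assume "norm p < 1"
    moreover obtain I x y where "I \<in> unit_imag_quats" "p = of_real x + I * of_real y"
      by (rule quat_slice_decomposition)
    ultimately show "(\<lambda>k. p ^ k * c J k) sums f p"
      using c[of I x y] same[OF J, of I] by simp
  qed
qed

section \<open>Gram factorisation of positive semidefinite quaternionic matrices\<close>

text \<open>Cholesky factorisation, by induction on the index set: the Schur complement of a diagonal entry is
again positive semidefinite, because its form at \<open>c\<close> is the form of \<open>P\<close> at the extension of \<open>c\<close>
that minimises over the additional coordinate. With \<open>1 / 0 = 0\<close> the same formulas cover a
vanishing diagonal entry, whose row vanishes as well.\<close>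

lemma quat_psd_gram:
  fixes P :: "'i \<Rightarrow> 'i \<Rightarrow> quat"
  assumes "finite A"
    and "\<And>i j. i \<in> A \<Longrightarrow> j \<in> A \<Longrightarrow> P j i = qcnj (P i j)"
    and "\<And>c. 0 \<le> qre (\<Sum>i\<in>A. \<Sum>j\<in>A. qcnj (c i) * P i j * c j)"
  shows "\<exists>b. \<forall>i\<in>A. \<forall>j\<in>A. P i j = (\<Sum>k\<in>A. b i k * qcnj (b j k))"
  using assms
proof (induction A arbitrary: P rule: finite_induct)
  case (insert a A)
  note herm = insert.prems(1) and psd = insert.prems(2)
  define d where "d = qre (P a a)"
  have Paa: "P a a = of_real d"
    using herm[of a a] by (simp add: quat_eq_iff d_def)
  have expand: "(\<Sum>i\<in>insert a A. \<Sum>j\<in>insert a A. qcnj (c i) * P i j * c j)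
      = qcnj (c a) * of_real d * c a + qcnj (c a) * (\<Sum>j\<in>A. P a j * c j)
        + qcnj (\<Sum>j\<in>A. P a j * c j) * c a + (\<Sum>i\<in>A. \<Sum>j\<in>A. qcnj (c i) * P i j * c j)" for c
  proof -
    have "(\<Sum>i\<in>A. qcnj (c i) * P i a * c a) = qcnj (\<Sum>j\<in>A. P a j * c j) * c a"
      unfolding qcnj_sum sum_distrib_right by (rule sum.cong) (auto simp: herm[of a])
    then show ?thesis
      using insert.hyps by (simp add: sum.distrib Paa sum_distrib_left mult.assoc)
  qed
  have d0: "0 \<le> d"
  proof -
    have "(\<Sum>j\<in>A. P a j * (if j = a then 1 else 0)) = 0"
      "(\<Sum>i\<in>A. \<Sum>j\<in>A. qcnj (if i = a then 1 else 0) * P i j * (if j = a then 1 else 0)) = 0"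
      using insert.hyps by (auto intro!: sum.neutral)
    then show ?thesis
      using psd[of "\<lambda>i. if i = a then 1 else 0"] unfolding expand by simp
  qed
  \<comment> \<open>Otherwise the form would be unbounded below along \<open>c a = - t * P a j\<close>, \<open>c j = 1\<close>; \<open>t\<close> is chosen
     to give the value \<open>- 1\<close>.\<close>
  have row0: "P a j = 0" if "d = 0" and j: "j \<in> A" for j
  proof (rule ccontr)
    assume nz: "P a j \<noteq> 0"
    define t where "t = (qre (P j j) + 1) / (2 * (norm (P a j))\<^sup>2)"
    define c where "c = (\<lambda>i. if i = a then - (of_real t * P a j) else if i = j then 1 else 0 :: quat)"
    have "(\<Sum>k\<in>A. P a k * c k) = (\<Sum>k\<in>A. if k = j then P a j else 0)"
      using insert.hyps by (intro sum.cong) (auto simp: c_def)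
    then have 1: "(\<Sum>k\<in>A. P a k * c k) = P a j" using j insert.hyps by simp
    have "qcnj (c i) * P i k * c k = (if i = j then if k = j then P j j else 0 else 0)"
      if "i \<in> A" "k \<in> A" for i k
      using insert.hyps that by (auto simp: c_def)
    then have "(\<Sum>i\<in>A. \<Sum>k\<in>A. qcnj (c i) * P i k * c k)
        = (\<Sum>i\<in>A. if i = j then (\<Sum>k\<in>A. if k = j then P j j else 0) else 0)"
      by (intro sum.cong) (auto intro!: sum.neutral)
    then have 2: "(\<Sum>i\<in>A. \<Sum>k\<in>A. qcnj (c i) * P i k * c k) = P j j"
      using j insert.hyps by simp
    have "0 \<le> qre (qcnj (c a) * P a j + qcnj (P a j) * c a + P j j)"
      using psd[of c] unfolding expand 1 2 \<open>d = 0\<close> by simp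
    also have "\<dots> = qre (P j j) - 2 * t * (norm (P a j))\<^sup>2"
      unfolding norm_quat_squared by (simp add: c_def power2_eq_square algebra_simps)
    also have "\<dots> = - 1" using nz by (simp add: t_def field_simps)
    finally show False by simp
  qed
  define Q where "Q i j = P i j - (1 / d) *\<^sub>R (P i a * P a j)" for i j
  have "\<exists>b. \<forall>i\<in>A. \<forall>j\<in>A. Q i j = (\<Sum>k\<in>A. b i k * qcnj (b j k))"
  proof (rule insert.IH)
    fix i j assume "i \<in> A" "j \<in> A"
    then show "Q j i = qcnj (Q i j)"
      using herm[of i j] herm[of a i] herm[of a j]
      by (simp add: Q_def insert.hyps)
  next
    fix c :: "'i \<Rightarrow> quat"
    define y where "y = (\<Sum>j\<in>A. P a j * c j)"
    \<comment> \<open>The minimiser over the coordinate \<open>a\<close>.\<close>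
    define c' where "c' = c(a := - ((1 / d) *\<^sub>R y))"
    have c'A: "c' i = c i" if "i \<in> A" for i using that insert.hyps by (auto simp: c'_def)
    have "qre (\<Sum>i\<in>A. \<Sum>j\<in>A. qcnj (c i) * Q i j * c j)
        = qre ((\<Sum>i\<in>A. \<Sum>j\<in>A. qcnj (c i) * P i j * c j)
          - (1 / d) *\<^sub>R (\<Sum>i\<in>A. \<Sum>j\<in>A. (qcnj (c i) * P i a) * (P a j * c j)))"
      by (simp add: Q_def algebra_simps sum_subtractf scaleR_sum_right mult.assoc)
    also have "(\<Sum>i\<in>A. \<Sum>j\<in>A. (qcnj (c i) * P i a) * (P a j * c j)) = qcnj y * y"
      unfolding y_def qcnj_sum sum_product using insert.hyps
      by (intro sum.cong) (auto simp: herm[of a])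
    also have "qre ((\<Sum>i\<in>A. \<Sum>j\<in>A. qcnj (c i) * P i j * c j) - (1 / d) *\<^sub>R (qcnj y * y))
        = qre (\<Sum>i\<in>insert a A. \<Sum>j\<in>insert a A. qcnj (c' i) * P i j * c' j)"
    proof -
      have c'a: "c' a = - ((1 / d) *\<^sub>R y)" by (simp add: c'_def)
      have y: "(\<Sum>j\<in>A. P a j * c' j) = y"
        and F: "(\<Sum>i\<in>A. \<Sum>j\<in>A. qcnj (c' i) * P i j * c' j) = (\<Sum>i\<in>A. \<Sum>j\<in>A. qcnj (c i) * P i j * c j)"
        using c'A by (simp_all add: y_def)
      show ?thesis
        unfolding expand y F c'a by (cases "d = 0") (simp_all add: field_simps)
    qed
    finally show "0 \<le> qre (\<Sum>i\<in>A. \<Sum>j\<in>A. qcnj (c i) * Q i j * c j)"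
      using psd[of c'] by simp
  qed
  then obtain b where b: "\<And>i j. i \<in> A \<Longrightarrow> j \<in> A \<Longrightarrow> Q i j = (\<Sum>k\<in>A. b i k * qcnj (b j k))"
    by blast
  define b' where "b' i k = (if k = a then (1 / sqrt d) *\<^sub>R P i a else if i = a then 0 else b i k)" for i k
  have ss: "(1 / sqrt d) * (1 / sqrt d) = 1 / d" using d0 by simp
  show ?case
  proof (intro exI ballI)
    fix i j assume ij: "i \<in> insert a A" "j \<in> insert a A"
    have "(\<Sum>k\<in>insert a A. b' i k * qcnj (b' j k))
        = (1 / d) *\<^sub>R (P i a * P a j) + (\<Sum>k\<in>A. b' i k * qcnj (b' j k))"
      using insert.hyps ij herm[of a j] ss by (simp add: b'_def)
    also have "(\<Sum>k\<in>A. b' i k * qcnj (b' j k)) = (if i = a \<or> j = a then 0 else Q i j)"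
      using ij insert.hyps b[of i j]
      by (auto simp: b'_def intro!: sum.neutral sum.cong)
    also have "(1 / d) *\<^sub>R (P i a * P a j) + (if i = a \<or> j = a then 0 else Q i j) = P i j"
      using ij row0[of i] row0[of j] herm[of a i] Paa
      by (cases "d = 0") (auto simp: Q_def quat_eq_iff)
    finally show "P i j = (\<Sum>k\<in>insert a A. b' i k * qcnj (b' j k))" by simp
  qed
qed simp

section \<open>Extending an isometry between submodules to a contraction\<close>

text \<open>The map sending \<open>f c\<close> to \<open>g c\<close> is a well-defined isometry on the range of \<open>f\<close>, and \<open>U\<close> is that
isometry after the orthogonal projection onto this range. The three families of maps describe a
scalar action. Since the range of \<open>f\<close> is invariant under the adjoints of the action, so is its
orthogonal complement; hence the projection, which is only real-linear by construction, commutes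
with the action. This transfers quaternionic linear algebra to real Euclidean spaces.\<close>

lemma equivariant_contraction_extension:
  fixes f :: "'a::real_vector \<Rightarrow> 'b::euclidean_space" and g :: "'a \<Rightarrow> 'c::real_normed_vector"
    and \<alpha> :: "'q \<Rightarrow> 'a \<Rightarrow> 'a" and \<beta> :: "'q \<Rightarrow> 'b \<Rightarrow> 'b" and \<gamma> :: "'q \<Rightarrow> 'c \<Rightarrow> 'c"
  assumes f: "linear f" and g: "linear g" and iso: "\<And>c. norm (g c) = norm (f c)"
    and \<beta>: "\<And>q. linear (\<beta> q)"
    and adj: "\<And>q x y. inner (\<beta> q x) y = inner x (\<beta> (adj q) y)"
    and f\<alpha>: "\<And>q c. f (\<alpha> q c) = \<beta> q (f c)" and g\<alpha>: "\<And>q c. g (\<alpha> q c) = \<gamma> q (g c)"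
  obtains U where "linear U" "\<And>w. norm (U w) \<le> norm w" "\<And>c. U (f c) = g c"
    "\<And>q w. U (\<beta> q w) = \<gamma> q (U w)"
proof -
  \<comment> \<open>\<open>f c\<close> is the orthogonal projection of \<open>w\<close>. The parameter \<open>c\<close> need not be unique, but \<open>g c\<close> is.\<close>
  define proj where "proj w c \<longleftrightarrow> (\<forall>d. inner (w - f c) (f d) = 0)" for w c
  have ex: "\<exists>c. proj w c" for w
  proof -
    have span: "span (range f) = range f"
      using linear_subspace_image[OF f subspace_UNIV] span_eq_iff by blast
    obtain y z where "y \<in> range f" "\<And>u. u \<in> range f \<Longrightarrow> orthogonal z u" "w = y + z"
      using orthogonal_subspace_decomp_exists[of "range f" w] span by metis
    then show ?thesis unfolding proj_def orthogonal_def by (metis add_diff_cancel_left' rangeE rangeI)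
  qed
  have unique: "g c = g c'" if "proj w c" "proj w c'" for w c c'
  proof -
    have "inner (w - f c) (f (c - c')) = 0" "inner (w - f c') (f (c - c')) = 0"
      using that by (auto simp: proj_def)
    then have "inner (f (c - c')) (f (c - c')) = 0"
      using linear_diff[OF f, of c c'] by (simp add: inner_diff_left)
    then have "norm (g (c - c')) = 0" by (simp add: iso)
    then show ?thesis using linear_diff[OF g, of c c'] by simp
  qed
  define U where "U w = g (SOME c. proj w c)" for w
  have U: "U w = g c" if "proj w c" for w c
    unfolding U_def by (rule unique[OF someI that]) (rule that)
  show thesis
  proof
    show "linear U"
    proof
      fix x y :: 'b and r :: real
      obtain c d where c: "proj x c" and d: "proj y d" using ex by blast
      have "proj (x + y) (c + d)"
        using c d unfolding proj_def linear_add[OF f]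
        by (simp add: algebra_simps inner_diff_left inner_add_left)
      then show "U (x + y) = U x + U y" using U c d linear_add[OF g] by metis
      have "proj (r *\<^sub>R x) (r *\<^sub>R c)"
        using c unfolding proj_def linear_cmul[OF f] by (simp flip: scaleR_diff_right)
      then show "U (r *\<^sub>R x) = r *\<^sub>R U x" using U c linear_cmul[OF g] by metis
    qed
    show "U (f c) = g c" for c by (rule U) (simp add: proj_def)
    show "U (\<beta> q w) = \<gamma> q (U w)" for q w
    proof -
      obtain c where c: "proj w c" using ex by blast
      have "inner (\<beta> q w - f (\<alpha> q c)) (f d) = inner (w - f c) (f (\<alpha> (adj q) d))" for d
        by (simp only: f\<alpha> linear_diff[OF \<beta>, symmetric] adj)
      then have "proj (\<beta> q w) (\<alpha> q c)"
        using c unfolding proj_def by simp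
      then show ?thesis using U c g\<alpha> by metis
    qed
    show "norm (U w) \<le> norm w" for w
    proof -
      obtain c where c: "proj w c" using ex by blast
      have "(norm w)\<^sup>2 = (norm (f c))\<^sup>2 + (norm (w - f c))\<^sup>2"
        using c norm_add_Pythagorean[of "f c" "w - f c"]
        by (simp add: proj_def orthogonal_def inner_commute)
      then have "(norm (f c))\<^sup>2 \<le> (norm w)\<^sup>2" by simp
      then show ?thesis using U[OF c] iso[of c] by (simp add: power2_le_iff_abs_le)
    qed
  qed
qed

section \<open>Transfer functions of contractive colligations\<close>

definition vscale :: "quat \<Rightarrow> quat ^ 'n \<Rightarrow> quat ^ 'n" where
  "vscale q v = (\<chi> i. q * v $ i)"

definition pscale :: "quat \<Rightarrow> (quat ^ 'n) \<times> quat \<Rightarrow> (quat ^ 'n) \<times> quat" where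
  "pscale q w = (vscale q (fst w), q * snd w)"

lemma norm_vscale: "norm (vscale q v) = norm q * norm v"
  by (simp add: vscale_def norm_vec_def norm_mult L2_set_right_distrib)

lemma linear_vscale: "linear (vscale q)"
  by (rule linearI) (simp_all add: vscale_def vec_eq_iff distrib_left)

lemma linear_pscale: "linear (pscale q)"
  by (rule linearI)
     (simp_all add: pscale_def linear_add[OF linear_vscale] linear_cmul[OF linear_vscale] distrib_left)

lemma inner_pscale: "inner (pscale q x) y = inner x (pscale (qcnj q) y)"
  by (simp add: pscale_def vscale_def inner_prod_def inner_vec_def inner_mult_left_quat)

lemma vscale_vscale: "vscale p (vscale q v) = vscale (p * q) v"
  by (simp add: vscale_def mult.assoc)

lemma norm_fst_le_prod: "norm (fst w) \<le> norm w" and norm_snd_le_prod: "norm (snd w) \<le> norm w"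
  using norm_fst_le[of "fst w" "snd w"] norm_snd_le[of "snd w" "fst w"] by simp_all

text \<open>The function realised by a contraction \<open>U\<close>: writing \<open>A v = fst (U (v, 0))\<close>, \<open>C = fst (U (0, 1))\<close>,
\<open>B v = snd (U (v, 0))\<close> and \<open>D = snd (U (0, 1))\<close>, it is
\<open>S p = D + (\<Sum>k. p ^ (k + 1) * B (A ^ k C))\<close>.
The state \<open>b = (\<Sum>k. p ^ k A ^ k C)\<close> satisfies \<open>U (p b, 1) = (b, S p)\<close>, and contractivity gives
\<open>|b|\<^sup>2 + |S p|\<^sup>2 \<le> |p b|\<^sup>2 + 1\<close>, whence \<open>|S p| \<le> 1\<close>. Because \<open>U\<close> commutes with left
scalars, powers of \<open>p\<close> stay on the left, as a slice regular series demands. For the interpolation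
property it suffices that the equation \<open>U (p b, 1) = (b, s)\<close> determines \<open>s\<close>: the difference of two solutions is mapped by the contraction \<open>U\<close> from \<open>(p v, 0)\<close> to \<open>(v, t)\<close>, which
forces \<open>t = 0\<close>.\<close>

lemma contractive_colligation_schur:
  fixes U :: "(quat ^ 'n) \<times> quat \<Rightarrow> (quat ^ 'n) \<times> quat"
  assumes lin: "linear U" and contr: "\<And>w. norm (U w) \<le> norm w"
    and equiv: "\<And>q w. U (pscale q w) = pscale q (U w)"
  shows "\<exists>S\<in>slice_schur_class. \<forall>p b s. norm p < 1 \<longrightarrow> U (vscale p b, 1) = (b, s) \<longrightarrow> S p = s"
proof -
  define A where "A v = fst (U (v, 0))" for v
  define C where "C = fst (U (0, 1))"
  define c where "c k = (case k of 0 \<Rightarrow> snd (U (0, 1)) | Suc m \<Rightarrow> snd (U ((A ^^ m) C, 0)))" for k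
  define S where "S p = (\<Sum>k. p ^ k * c k)" for p
  interpret U: bounded_linear U by (rule linear_conv_bounded_linear[THEN iffD1, OF lin])
  have normA: "norm (A v) \<le> norm v" for v
    unfolding A_def using order_trans[OF norm_fst_le_prod contr[of "(v, 0)"]] by (simp add: norm_Pair)
  have normAk: "norm ((A ^^ k) C) \<le> norm C" for k
    by (induction k) (auto intro: order_trans[OF normA])
  have normc: "norm (c k) \<le> 1 + norm C" for k
  proof (cases k)
    case 0
    have "norm (snd (U (0, 1))) \<le> norm (0 :: (quat ^ 'n), 1 :: quat)"
      by (rule order_trans[OF norm_snd_le_prod contr])
    then show ?thesis using 0 norm_ge_zero[of C] by (simp add: c_def norm_Pair del: norm_ge_zero)
  next
    case (Suc m)
    have "norm (snd (U ((A ^^ m) C, 0))) \<le> norm ((A ^^ m) C, 0 :: quat)"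
      by (rule order_trans[OF norm_snd_le_prod contr])
    then show ?thesis using Suc normAk[of m] by (simp add: c_def norm_Pair)
  qed
  have sc: "summable (\<lambda>k. norm (c k) * r ^ k)" if "0 \<le> r" "r < 1" for r
    by (rule summable_comparison_test'[where g = "\<lambda>k. (1 + norm C) * r ^ k"])
       (use that normc in \<open>auto intro!: summable_mult summable_geometric mult_right_mono simp: abs_mult\<close>)
  have main: "\<exists>b. U (vscale p b, 1) = (b, S p)" if p: "norm p < 1" for p
  proof -
    have "summable (\<lambda>k. vscale (p ^ k) ((A ^^ k) C))"
      by (rule summable_comparison_test'[where g = "\<lambda>k. norm p ^ k * norm C"])
         (use p normAk in \<open>auto intro!: summable_mult2 summable_geometric mult_left_mono simp: norm_vscale norm_power\<close>)
    then obtain b where b: "(\<lambda>k. vscale (p ^ k) ((A ^^ k) C)) sums b"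
      by (auto simp: summable_def)
    have Ss: "(\<lambda>k. p ^ k * c k) sums S p" unfolding S_def
      by (rule summable_sums, rule summable_norm_cancel,
          rule summable_comparison_test'[OF sc[of "norm p"]])
         (use p in \<open>auto simp: norm_mult norm_power\<close>)
    have "bounded_linear (\<lambda>v. (vscale p v, 0 :: quat))"
      by (intro bounded_linear_Pair bounded_linear_zero
          linear_conv_bounded_linear[THEN iffD1, OF linear_vscale])
    from bounded_linear.sums[OF bounded_linear_compose[OF U.bounded_linear_axioms this] b]
    have *: "(\<lambda>k. U (vscale p (vscale (p ^ k) ((A ^^ k) C)), 0)) sums U (vscale p b, 0)" .
    have "U (vscale p (vscale (p ^ k) ((A ^^ k) C)), 0)
        = (vscale (p ^ Suc k) ((A ^^ Suc k) C), p ^ Suc k * c (Suc k))" for k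
      using equiv[of "p ^ Suc k" "((A ^^ k) C, 0)"]
      by (simp add: vscale_vscale pscale_def A_def c_def)
    with * have *: "(\<lambda>k. (vscale (p ^ Suc k) ((A ^^ Suc k) C), p ^ Suc k * c (Suc k))) sums U (vscale p b, 0)"
      by simp
    have "(\<lambda>k. vscale (p ^ Suc k) ((A ^^ Suc k) C)) sums (b - C)"
      using b sums_Suc_iff[of "\<lambda>k. vscale (p ^ k) ((A ^^ k) C)" "b - C"]
      by (simp add: vscale_def)
    with bounded_linear.sums[OF bounded_linear_fst *] have 1: "fst (U (vscale p b, 0)) = b - C"
      by (auto dest: sums_unique2)
    have "(\<lambda>k. p ^ Suc k * c (Suc k)) sums (S p - c 0)"
      using Ss sums_Suc_iff[of "\<lambda>k. p ^ k * c k" "S p - c 0"] by simp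
    with bounded_linear.sums[OF bounded_linear_snd *] have 2: "snd (U (vscale p b, 0)) = S p - c 0"
      by (auto dest: sums_unique2)
    have "U (vscale p b, 1) = U (vscale p b, 0) + U (0, 1)"
      using U.add[of "(vscale p b, 0)" "(0, 1)"] by simp
    also have "\<dots> = (b, S p)"
      using 1 2 by (simp add: prod_eq_iff C_def c_def)
    finally show ?thesis by blast
  qed
  show ?thesis
  proof (rule bexI[where x = S], intro allI impI)
    fix p b s assume p: "norm p < 1" and U1: "U (vscale p b, 1) = (b, s)"
    obtain b' where b': "U (vscale p b', 1) = (b', S p)" using main[OF p] by blast
    have "U (vscale p (b - b'), 0) = (b - b', s - S p)"
      using U.diff[of "(vscale p b, 1)" "(vscale p b', 1)"] U1 b'
      by (simp add: linear_diff[OF linear_vscale])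
    then have "norm (b - b', s - S p) \<le> norm (vscale p (b - b'), 0 :: quat)"
      using contr by metis
    then have le: "(norm (b - b'))\<^sup>2 + (norm (s - S p))\<^sup>2 \<le> (norm p * norm (b - b'))\<^sup>2"
      by (simp add: norm_Pair norm_vscale real_le_rsqrt real_sqrt_le_iff sqrt_le_D)
    have "(norm p * norm (b - b'))\<^sup>2 \<le> (norm (b - b'))\<^sup>2"
      using p by (intro power_mono) (auto intro: mult_left_le_one_le)
    with le have "(norm (s - S p))\<^sup>2 \<le> 0" by linarith
    then show "S p = s" by simp
  next
    have "norm (S p) \<le> 1" if p: "norm p < 1" for p
    proof -
      obtain b where b: "U (vscale p b, 1) = (b, S p)" using main[OF p] by blast
      have "norm (b, S p) \<le> norm (vscale p b, 1 :: quat)" using contr b by metis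
      then have "(norm b)\<^sup>2 + (norm (S p))\<^sup>2 \<le> (norm p * norm b)\<^sup>2 + 1"
        by (simp add: norm_Pair norm_vscale)
      moreover have "(norm p * norm b)\<^sup>2 \<le> (norm b)\<^sup>2"
        using p by (intro power_mono) (auto intro: mult_left_le_one_le)
      ultimately have "(norm (S p))\<^sup>2 \<le> 1\<^sup>2" by (simp del: power_mono_iff power2_le_iff_abs_le)
      then show ?thesis by (rule power2_le_imp_le) simp
    qed
    moreover have "slice_regular_on (ball 0 1) S"
      unfolding S_def by (rule power_series_slice_regular[OF sc])
    ultimately show "S \<in> slice_schur_class" by (simp add: slice_schur_class_def)
  qed
qed

section \<open>Toeplitz operators of Schur functions\<close>

lemma roots_of_unity_orthogonal:
  assumes "k < n" "m < n" and \<omega>: "\<omega> = cis (2 * pi / real n)"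
  shows "(\<Sum>l<n. (\<omega> ^ k * cnj \<omega> ^ m) ^ l) = (if k = m then of_nat n else 0)"
proof -
  have n: "n > 0" using assms by simp
  have unit: "\<omega> * cnj \<omega> = 1" by (simp add: \<omega> cis_cnj cis_mult)
  have \<omega>n: "\<omega> ^ n = 1" using n unfolding \<omega> Complex.DeMoivre by simp
  show ?thesis
  proof (cases "k = m")
    case True
    then show ?thesis using unit by (simp flip: power_mult_distrib)
  next
    case False
    let ?z = "\<omega> ^ k * cnj \<omega> ^ m"
    have "?z \<noteq> 1"
    proof
      assume "?z = 1"
      then have "\<omega> ^ k * (cnj \<omega> * \<omega>) ^ m = \<omega> ^ m" by (simp add: power_mult_distrib mult.assoc[symmetric])
      then have "\<omega> ^ k = \<omega> ^ m" using unit by (simp add: mult.commute)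
      then have "cis (2 * pi * real k / real n) = cis (2 * pi * real m / real n)"
        by (simp add: \<omega> Complex.DeMoivre mult_ac)
      then show False
        using Complex.bij_betw_roots_unity[OF n] assms(1,2) False by (auto simp: bij_betw_def inj_on_def)
    qed
    moreover have "?z ^ n = 1"
    proof -
      have "?z ^ n = (\<omega> ^ n) ^ k * cnj (\<omega> ^ n) ^ m"
        by (simp add: power_mult_distrib mult.commute flip: power_mult)
      then show ?thesis using \<omega>n by simp
    qed
    ultimately show ?thesis using False by (simp add: sum_gp_strict)
  qed
qed

text \<open>The powers of \<open>w\<close> stand to the right of the coefficients; in the expansion of the norm squares
they meet each other in the middle, inside the commutative standard complex plane, and orthogonality
of the characters applies there.\<close>

lemma discrete_parseval:
  fixes g :: "nat \<Rightarrow> quat"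
  assumes w: "w = quat_of_complex (cis (2 * pi / real n))"
  shows "(\<Sum>l<n. (norm (\<Sum>k<n. g k * (w ^ l) ^ k))\<^sup>2) = real n * (\<Sum>k<n. (norm (g k))\<^sup>2)"
proof -
  define \<omega> where "\<omega> = cis (2 * pi / real n)"
  have "(\<Sum>l<n. (norm (\<Sum>k<n. g k * (w ^ l) ^ k))\<^sup>2)
      = (\<Sum>l<n. \<Sum>k<n. \<Sum>m<n. qre (g k * quat_of_complex ((\<omega> ^ k * cnj \<omega> ^ m) ^ l) * qcnj (g m)))"
  proof (rule sum.cong)
    fix l
    have "inner (g k * (w ^ l) ^ k) (g m * (w ^ l) ^ m)
        = qre (g k * quat_of_complex ((\<omega> ^ k * cnj \<omega> ^ m) ^ l) * qcnj (g m))" for k m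
    proof -
      have "(w ^ l) ^ k * qcnj ((w ^ l) ^ m) = quat_of_complex ((\<omega> ^ l) ^ k * (cnj \<omega> ^ l) ^ m)"
        by (simp add: w \<omega>_def quat_of_complex_power)
      also have "(\<omega> ^ l) ^ k * (cnj \<omega> ^ l) ^ m = (\<omega> ^ k * cnj \<omega> ^ m) ^ l"
        by (simp add: power_mult_distrib mult.commute flip: power_mult)
      finally show ?thesis
        unfolding inner_quat_eq qcnj_simps mult.assoc[symmetric] by (simp only: mult.assoc)
    qed
    then show "(norm (\<Sum>k<n. g k * (w ^ l) ^ k))\<^sup>2
        = (\<Sum>k<n. \<Sum>m<n. qre (g k * quat_of_complex ((\<omega> ^ k * cnj \<omega> ^ m) ^ l) * qcnj (g m)))"
      by (simp only: power2_norm_eq_inner inner_sum_left inner_sum_right) (rule sum.swap)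
  qed simp
  also have "\<dots> = (\<Sum>k<n. \<Sum>m<n. \<Sum>l<n. qre (g k * quat_of_complex ((\<omega> ^ k * cnj \<omega> ^ m) ^ l) * qcnj (g m)))"
    by (subst sum.swap) (intro sum.cong refl sum.swap)
  also have "\<dots> = (\<Sum>k<n. \<Sum>m<n. if k = m then real n * (norm (g k))\<^sup>2 else 0)"
  proof (intro sum.cong refl)
    fix k m assume "k \<in> {..<n}" "m \<in> {..<n}"
    then have km: "k < n" "m < n" by auto
    have "(\<Sum>l<n. qre (g k * quat_of_complex ((\<omega> ^ k * cnj \<omega> ^ m) ^ l) * qcnj (g m)))
        = qre (g k * quat_of_complex (\<Sum>l<n. (\<omega> ^ k * cnj \<omega> ^ m) ^ l) * qcnj (g m))"
      by (simp only: quat_of_complex_sum sum_distrib_left sum_distrib_right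
          linear_sum[OF bounded_linear.linear[OF bounded_linear_qre]] o_def)
    also have "\<dots> = (if k = m then real n * (norm (g k))\<^sup>2 else 0)"
      unfolding roots_of_unity_orthogonal[OF km \<omega>_def]
      by (auto simp: norm_quat_squared) (simp add: power2_eq_square algebra_simps)
    finally show "(\<Sum>l<n. qre (g k * quat_of_complex ((\<omega> ^ k * cnj \<omega> ^ m) ^ l) * qcnj (g m)))
        = (if k = m then real n * (norm (g k))\<^sup>2 else 0)" .
  qed
  finally show ?thesis by (simp add: sum_distrib_left)
qed

text \<open>The convolution \<open>G\<close> of \<open>a\<close> and \<open>F\<close> has the transform \<open>\<Sum>m. a m * x * v ^ m\<close> at a complex
unit \<open>v\<close>, where \<open>x\<close> is the transform of \<open>F\<close>. Conjugation by \<open>x\<close> moves the powers past \<open>x\<close>: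
the value is \<open>(\<Sum>m. a m * q ^ m) * x\<close> with \<open>q = x * v * inverse x\<close>, again a unit quaternion. So the
transform is bounded pointwise, and the Parseval identity for the \<open>L\<close>-th roots of unity
transfers this to the coefficients; \<open>L\<close> exceeds the degree of \<open>G\<close>, which rules out aliasing.
Since \<open>q\<close> leaves the standard complex plane, the bound is required on the whole unit sphere.\<close>

lemma polynomial_toeplitz_bound:
  fixes a f :: "nat \<Rightarrow> quat"
  assumes bound: "\<And>q. norm q = 1 \<Longrightarrow> norm (\<Sum>m<M. a m * q ^ m) \<le> C"
    and "N \<le> M"
  shows "(\<Sum>k<N. (norm (\<Sum>m\<le>k. a m * f (k - m)))\<^sup>2) \<le> C\<^sup>2 * (\<Sum>k<N. (norm (f k))\<^sup>2)"
proof -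
  define L where "L = N + M"
  define w where "w = quat_of_complex (cis (2 * pi / real L))"
  define F where "F k = (if k < N then f k else 0)" for k
  define G where "G k = (\<Sum>m<M. a m * (if m \<le> k then F (k - m) else 0))" for k
  have pointwise: "norm (\<Sum>k<L. G k * v ^ k) \<le> C * norm (\<Sum>k<L. F k * v ^ k)" if v: "norm v = 1" for v
  proof -
    define x where "x = (\<Sum>k<L. F k * v ^ k)"
    have shift: "(\<Sum>k<L. (if m \<le> k then F (k - m) else 0) * v ^ k) = x * v ^ m" if "m < M" for m
    proof -
      have "x * v ^ m = (\<Sum>k=0..<N. F (k + m - m) * v ^ (k + m))"
        unfolding x_def sum_distrib_right
        by (rule sum.mono_neutral_cong_right) (auto simp: L_def F_def power_add mult.assoc)
      also have "\<dots> = (\<Sum>k=0+m..<N+m. F (k - m) * v ^ k)"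
        by (rule sum.shift_bounds_nat_ivl[symmetric])
      also have "\<dots> = (\<Sum>k<L. (if m \<le> k then F (k - m) else 0) * v ^ k)"
        by (rule sum.mono_neutral_cong_left) (use that in \<open>auto simp: L_def F_def\<close>)
      finally show ?thesis by simp
    qed
    have "(\<Sum>k<L. G k * v ^ k) = (\<Sum>m<M. \<Sum>k<L. a m * ((if m \<le> k then F (k - m) else 0) * v ^ k))"
      unfolding G_def sum_distrib_right mult.assoc by (rule sum.swap)
    also have "\<dots> = (\<Sum>m<M. a m * (x * v ^ m))"
      unfolding sum_distrib_left[symmetric] using shift by simp
    finally have eq: "(\<Sum>k<L. G k * v ^ k) = (\<Sum>m<M. a m * (x * v ^ m))" .
    show ?thesis
    proof (cases "x = 0")
      case False
      define q where "q = x * v * inverse x"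
      have "x * v ^ m = q ^ m * x" for m
      proof (induction m)
        case (Suc m)
        have "q ^ Suc m * x = q * (x * v ^ m)" by (simp add: Suc mult.assoc)
        also have "\<dots> = x * v * (inverse x * x) * v ^ m" by (simp add: q_def mult.assoc)
        also have "\<dots> = x * v ^ Suc m" using False by (simp add: mult.assoc)
        finally show ?case by simp
      qed simp
      then have "(\<Sum>k<L. G k * v ^ k) = (\<Sum>m<M. a m * q ^ m) * x"
        unfolding eq by (simp add: sum_distrib_right mult.assoc)
      moreover have "norm q = 1" using False v by (simp add: q_def norm_mult norm_inverse)
      ultimately show ?thesis
        using bound[of q] by (simp add: norm_mult x_def[symmetric] mult_right_mono)
    qed (simp add: eq x_def[symmetric])
  qed
  have norm_w: "norm (w ^ l) = 1" for l by (simp add: w_def norm_power)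
  have "real L * (\<Sum>k<L. (norm (G k))\<^sup>2) = (\<Sum>l<L. (norm (\<Sum>k<L. G k * (w ^ l) ^ k))\<^sup>2)"
    by (rule discrete_parseval[symmetric]) (rule w_def)
  also have "\<dots> \<le> (\<Sum>l<L. (C * norm (\<Sum>k<L. F k * (w ^ l) ^ k))\<^sup>2)"
    by (intro sum_mono power_mono pointwise norm_w norm_ge_zero)
  also have "\<dots> = C\<^sup>2 * (real L * (\<Sum>k<L. (norm (F k))\<^sup>2))"
    by (simp only: power_mult_distrib sum_distrib_left[symmetric] discrete_parseval[OF w_def])
  finally have "L = 0 \<or> (\<Sum>k<L. (norm (G k))\<^sup>2) \<le> C\<^sup>2 * (\<Sum>k<L. (norm (F k))\<^sup>2)"
    by (auto simp: mult.left_commute[of "C\<^sup>2"] mult_le_cancel_left)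
  then have le: "(\<Sum>k<L. (norm (G k))\<^sup>2) \<le> C\<^sup>2 * (\<Sum>k<L. (norm (F k))\<^sup>2)" by auto
  have "(\<Sum>k<N. (norm (\<Sum>m\<le>k. a m * f (k - m)))\<^sup>2) = (\<Sum>k<N. (norm (G k))\<^sup>2)"
  proof (intro sum.cong refl)
    fix k assume k: "k \<in> {..<N}"
    have "(\<Sum>m\<le>k. a m * f (k - m)) = G k" unfolding G_def
      by (rule sum.mono_neutral_cong_left) (use k \<open>N \<le> M\<close> in \<open>auto simp: F_def\<close>)
    then show "(norm (\<Sum>m\<le>k. a m * f (k - m)))\<^sup>2 = (norm (G k))\<^sup>2" by simp
  qed
  also have "\<dots> \<le> (\<Sum>k<L. (norm (G k))\<^sup>2)" by (rule sum_mono2) (auto simp: L_def)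
  also have "\<dots> \<le> C\<^sup>2 * (\<Sum>k<L. (norm (F k))\<^sup>2)" by (rule le)
  also have "(\<Sum>k<L. (norm (F k))\<^sup>2) = (\<Sum>k<N. (norm (f k))\<^sup>2)"
    by (rule sum.mono_neutral_cong_right) (auto simp: F_def L_def)
  finally show ?thesis .
qed

text \<open>The symbol with the conjugated coefficients to the left of the powers is the conjugate of \<open>S\<close> at the
conjugate point, hence bounded by \<open>1\<close> too. Partial sums of its dilation by \<open>r < 1\<close> are bounded by
\<open>1\<close> plus a tail \<open>t M\<close> uniformly on the unit sphere; then \<open>M\<close> tends to infinity and \<open>r\<close> to \<open>1\<close>.\<close>

lemma schur_toeplitz_contraction:
  fixes c f :: "nat \<Rightarrow> quat"
  assumes S: "\<And>p. norm p < 1 \<Longrightarrow> (\<lambda>k. p ^ k * c k) sums S p"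
    and bound: "\<And>p. norm p < 1 \<Longrightarrow> norm (S p) \<le> 1"
  shows "(\<Sum>k<N. (norm (\<Sum>m\<le>k. qcnj (c m) * f (k - m)))\<^sup>2) \<le> (\<Sum>k<N. (norm (f k))\<^sup>2)"
proof -
  define \<Phi> where "\<Phi> r = (\<Sum>k<N. (norm (\<Sum>m\<le>k. (r ^ m *\<^sub>R qcnj (c m)) * f (k - m)))\<^sup>2)" for r :: real
  have \<Phi>_le: "\<Phi> r \<le> (\<Sum>k<N. (norm (f k))\<^sup>2)" if r: "0 < r" "r < 1" for r
  proof -
    obtain r' where r': "r < r'" "r' < 1" using dense r(2) by blast
    have "summable (\<lambda>k. c k * of_real r' ^ k)"
      using S[of "of_real r'", THEN sums_summable] r r' of_real_commute_quat[of "r' ^ _"] by simp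
    from powser_insidea[OF this, of "of_real r"]
    have sc: "summable (\<lambda>k. r ^ k * norm (c k))"
      using r r' by (simp add: norm_mult norm_power mult.commute)
    define t where "t M = (\<Sum>k. r ^ (k + M) * norm (c (k + M)))" for M
    have t0: "t \<longlonglongrightarrow> 0" unfolding t_def by (rule suminf_exist_split2[OF sc])
    have "\<Phi> r \<le> (1 + t M)\<^sup>2 * (\<Sum>k<N. (norm (f k))\<^sup>2)" if "N \<le> M" for M
      unfolding \<Phi>_def
    proof (rule polynomial_toeplitz_bound[OF _ that])
      fix q :: quat assume q: "norm q = 1"
      define p where "p = r *\<^sub>R qcnj q"
      have p: "norm p = r" using r q by (simp add: p_def)
      have sums: "(\<lambda>k. p ^ k * c k) sums S p" using S p r by simp
      have "(\<Sum>m<M. (r ^ m *\<^sub>R qcnj (c m)) * q ^ m) = qcnj (\<Sum>m<M. p ^ m * c m)"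
        by (simp add: qcnj_sum p_def scaleR_power)
      moreover have "norm (\<Sum>m<M. p ^ m * c m) \<le> norm (S p) + norm (\<Sum>k. p ^ (k + M) * c (k + M))"
        using suminf_split_initial_segment[OF sums_summable[OF sums], of M] sums_unique[OF sums]
          norm_triangle_ineq4[of "S p" "\<Sum>k. p ^ (k + M) * c (k + M)"] by simp
      moreover have "norm (\<Sum>k. p ^ (k + M) * c (k + M)) \<le> t M"
        using summable_norm[of "\<lambda>k. p ^ (k + M) * c (k + M)"] summable_ignore_initial_segment[OF sc, of M]
        by (simp add: norm_mult norm_power p t_def)
      ultimately show "norm (\<Sum>m<M. (r ^ m *\<^sub>R qcnj (c m)) * q ^ m) \<le> 1 + t M"
        using bound[of p] p r by simp
    qed
    moreover have "(\<lambda>M. (1 + t M)\<^sup>2 * (\<Sum>k<N. (norm (f k))\<^sup>2)) \<longlonglongrightarrow> (1 + 0)\<^sup>2 * (\<Sum>k<N. (norm (f k))\<^sup>2)"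
      by (intro tendsto_intros t0)
    ultimately show ?thesis using LIMSEQ_le_const by fastforce
  qed
  have "isCont \<Phi> 1" unfolding \<Phi>_def by (intro continuous_intros)
  then have "(\<Phi> \<longlongrightarrow> \<Phi> 1) (at_left 1)"
    unfolding isCont_def by (rule tendsto_within_subset[where S = UNIV]) simp
  then have "\<Phi> 1 \<le> (\<Sum>k<N. (norm (f k))\<^sup>2)"
    by (rule tendsto_upperbound) (auto intro!: eventually_at_leftI[of 0] \<Phi>_le)
  then show ?thesis by (simp add: \<Phi>_def)
qed

text \<open>The adjoint of multiplication by \<open>S\<close> on square-summable sequences is a contraction. Reversing the order
of the first \<open>N\<close> entries turns a finite section of this upper triangular Toeplitz operator into
the lower triangular one with the same entries, which is already known to be contractive.\<close>

lemma schur_adjoint_contraction: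
  fixes c g h :: "nat \<Rightarrow> quat"
  assumes S: "\<And>p. norm p < 1 \<Longrightarrow> (\<lambda>k. p ^ k * c k) sums S p"
    and bound: "\<And>p. norm p < 1 \<Longrightarrow> norm (S p) \<le> 1"
    and g: "\<And>k. (\<lambda>m. qcnj (c m) * h (k + m)) sums g k"
    and h: "summable (\<lambda>k. (norm (h k))\<^sup>2)"
  shows "summable (\<lambda>k. (norm (g k))\<^sup>2)" and "(\<Sum>k. (norm (g k))\<^sup>2) \<le> (\<Sum>k. (norm (h k))\<^sup>2)"
proof -
  have truncated: "(\<Sum>k<N. (norm (\<Sum>m<N - k. qcnj (c m) * h (k + m)))\<^sup>2) \<le> (\<Sum>k<N. (norm (h k))\<^sup>2)" for N
  proof -
    have "(\<Sum>k<N. (norm (\<Sum>m\<le>k. qcnj (c m) * h (N - Suc (k - m))))\<^sup>2) \<le> (\<Sum>k<N. (norm (h (N - Suc k)))\<^sup>2)"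
      by (rule schur_toeplitz_contraction[OF S bound])
    also have "\<dots> = (\<Sum>k<N. (norm (h k))\<^sup>2)" by (rule sum.nat_diff_reindex)
    also have "(\<Sum>k<N. (norm (\<Sum>m\<le>k. qcnj (c m) * h (N - Suc (k - m))))\<^sup>2)
        = (\<Sum>k<N. (norm (\<Sum>m\<le>N - Suc k. qcnj (c m) * h (N - Suc (N - Suc k - m))))\<^sup>2)"
      by (rule sum.nat_diff_reindex[symmetric])
    also have "\<dots> = (\<Sum>k<N. (norm (\<Sum>m<N - k. qcnj (c m) * h (k + m)))\<^sup>2)"
    proof (intro sum.cong refl)
      fix k assume "k \<in> {..<N}"
      then have "(\<Sum>m\<le>N - Suc k. qcnj (c m) * h (N - Suc (N - Suc k - m)))
          = (\<Sum>m<N - k. qcnj (c m) * h (k + m))"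
        by (intro sum.cong arg_cong2[of _ _ _ _ "(*)"] arg_cong[of _ _ h]) auto
      then show "(norm (\<Sum>m\<le>N - Suc k. qcnj (c m) * h (N - Suc (N - Suc k - m))))\<^sup>2
          = (norm (\<Sum>m<N - k. qcnj (c m) * h (k + m)))\<^sup>2" by simp
    qed
    finally show ?thesis .
  qed
  have bd: "(\<Sum>k<K. (norm (g k))\<^sup>2) \<le> (\<Sum>k. (norm (h k))\<^sup>2)" for K
  proof (rule LIMSEQ_le_const2)
    show "(\<lambda>N. \<Sum>k<K. (norm (\<Sum>m<N - k. qcnj (c m) * h (k + m)))\<^sup>2) \<longlonglongrightarrow> (\<Sum>k<K. (norm (g k))\<^sup>2)"
    proof (intro tendsto_sum tendsto_power tendsto_norm)
      fix k
      show "(\<lambda>N. \<Sum>m<N - k. qcnj (c m) * h (k + m)) \<longlonglongrightarrow> g k"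
        by (rule LIMSEQ_offset[where k = k]) (use g[of k] in \<open>simp add: sums_def\<close>)
    qed
    have "(\<Sum>k<K. (norm (\<Sum>m<N - k. qcnj (c m) * h (k + m)))\<^sup>2) \<le> (\<Sum>k. (norm (h k))\<^sup>2)" if "K \<le> N" for N
    proof -
      have "(\<Sum>k<K. (norm (\<Sum>m<N - k. qcnj (c m) * h (k + m)))\<^sup>2)
          \<le> (\<Sum>k<N. (norm (\<Sum>m<N - k. qcnj (c m) * h (k + m)))\<^sup>2)"
        by (rule sum_mono2) (use that in auto)
      also note truncated
      also have "(\<Sum>k<N. (norm (h k))\<^sup>2) \<le> (\<Sum>k. (norm (h k))\<^sup>2)"
        by (rule sum_le_suminf[OF h]) auto
      finally show ?thesis .
    qed
    then show "\<exists>N0. \<forall>N\<ge>N0. (\<Sum>k<K. (norm (\<Sum>m<N - k. qcnj (c m) * h (k + m)))\<^sup>2) \<le> (\<Sum>k. (norm (h k))\<^sup>2)"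
      by blast
  qed
  show s: "summable (\<lambda>k. (norm (g k))\<^sup>2)"
    by (rule summableI_nonneg_bounded[OF _ bd]) simp
  show "(\<Sum>k. (norm (g k))\<^sup>2) \<le> (\<Sum>k. (norm (h k))\<^sup>2)"
    by (rule suminf_le_const[OF s bd])
qed

section \<open>The Pick matrix\<close>

lemma pick_summable:
  fixes p q x :: quat
  assumes "norm p < 1" "norm q < 1"
  shows "summable (\<lambda>k. p ^ k * x * qcnj q ^ k)"
proof (rule summable_comparison_test'[where g = "\<lambda>k. norm x * norm p ^ k"])
  show "summable (\<lambda>k. norm x * norm p ^ k)" using assms by (intro summable_mult summable_geometric) simp
  show "norm (p ^ k * x * qcnj q ^ k) \<le> norm x * norm p ^ k" for k
    using assms(2) mult_left_le[of "norm q ^ k" "norm p ^ k * norm x"]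
    by (simp add: norm_mult norm_power power_le_one mult.commute)
qed

lemma pick_matrix_sums:
  assumes "\<And>i. norm (p $ i) < 1"
  shows "(\<lambda>k. p $ i ^ k * (1 - s $ i * qcnj (s $ j)) * qcnj (p $ j) ^ k) sums (pick_matrix p s $ i $ j)"
  unfolding pick_matrix_def vec_lambda_beta by (rule summable_sums[OF pick_summable[OF assms assms]])

lemma pick_matrix_hermitian:
  assumes "\<And>i. norm (p $ i) < 1"
  shows "pick_matrix p s $ j $ i = qcnj (pick_matrix p s $ i $ j)"
  using bounded_linear.sums[OF bounded_linear_qcnj pick_matrix_sums[OF assms, of i s j]]
    pick_matrix_sums[OF assms, of j s i]
  by (simp add: mult.assoc sums_unique2)

text \<open>Splitting off the first term of the series yields the Stein equation. Once \<open>P\<close> is a Gram matrix it says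
that two families of vectors have the same Gram matrix.\<close>

lemma pick_matrix_stein:
  assumes "\<And>i. norm (p $ i) < 1"
  shows "pick_matrix p s $ i $ j + s $ i * qcnj (s $ j) = p $ i * pick_matrix p s $ i $ j * qcnj (p $ j) + 1"
proof -
  let ?T = "\<lambda>k. p $ i ^ k * (1 - s $ i * qcnj (s $ j)) * qcnj (p $ j) ^ k"
  have "(\<lambda>k. p $ i * ?T k * qcnj (p $ j)) sums (p $ i * pick_matrix p s $ i $ j * qcnj (p $ j))"
    by (intro sums_mult sums_mult2 pick_matrix_sums assms)
  then have "(\<lambda>k. ?T (Suc k)) sums (p $ i * pick_matrix p s $ i $ j * qcnj (p $ j))"
    by (simp add: mult.assoc power_commutes)
  from sums_unique2[OF sums_Suc[OF this] pick_matrix_sums[OF assms]]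
  show ?thesis by (simp add: algebra_simps)
qed

lemma hermitian_form_eq:
  "(\<Sum>i\<in>UNIV. qcnj (c $ i) * (A *v c) $ i) = (\<Sum>i\<in>UNIV. \<Sum>j\<in>UNIV. qcnj (c $ i) * A $ i $ j * (c $ j :: quat))"
  by (simp add: matrix_vector_mult_def sum_distrib_left mult.assoc)

text \<open>With \<open>h k = (\<Sum>j. qcnj (p j) ^ k * x j)\<close>, summing the conjugated series of \<open>S\<close> at each \<open>p j\<close> shows that
the adjoint of multiplication by \<open>S\<close> maps \<open>h\<close> to \<open>g k = (\<Sum>j. qcnj (s j) * qcnj (p j) ^ k * x j)\<close>. The form of the Pick
matrix at \<open>x\<close> is the square norm of \<open>h\<close> minus that of \<open>g\<close>.\<close>

lemma schur_interpolant_imp_pick_psd: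
  fixes p s :: "quat ^ 'n"
  assumes p: "\<And>i. norm (p $ i) < 1" and S: "S \<in> slice_schur_class" "\<And>i. S (p $ i) = s $ i"
  shows "quat_psd (pick_matrix p s)"
  unfolding quat_psd_def
proof (intro conjI allI)
  show "quat_hermitian (pick_matrix p s)"
    unfolding quat_hermitian_def using pick_matrix_hermitian[OF p] by blast
  fix x :: "quat ^ 'n"
  obtain c where c: "\<And>q. norm q < 1 \<Longrightarrow> (\<lambda>k. q ^ k * c k) sums S q"
    using slice_regular_imp_power_series S(1) unfolding slice_schur_class_def by blast
  have bound: "norm (S q) \<le> 1" if "norm q < 1" for q
    using S(1) that by (simp add: slice_schur_class_def)
  define h where "h k = (\<Sum>j\<in>UNIV. qcnj (p $ j) ^ k * x $ j)" for k
  define g where "g k = (\<Sum>j\<in>UNIV. qcnj (s $ j) * qcnj (p $ j) ^ k * x $ j)" for k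
  have g: "(\<lambda>m. qcnj (c m) * h (k + m)) sums g k" for k
  proof -
    have "(\<lambda>m. \<Sum>j\<in>UNIV. qcnj (p $ j ^ m * c m) * (qcnj (p $ j) ^ k * x $ j))
        sums (\<Sum>j\<in>UNIV. qcnj (s $ j) * (qcnj (p $ j) ^ k * x $ j))"
      unfolding S(2)[symmetric]
      by (intro sums_sum sums_mult2 bounded_linear.sums[OF bounded_linear_qcnj] c p)
    moreover have "qcnj (c m) * h (k + m) = (\<Sum>j\<in>UNIV. qcnj (p $ j ^ m * c m) * (qcnj (p $ j) ^ k * x $ j))" for m
      unfolding h_def sum_distrib_left by (simp add: add.commute[of k] power_add mult.assoc)
    ultimately show ?thesis by (simp add: g_def mult.assoc)
  qed
  have hh: "qcnj (h k) * h k = (\<Sum>i\<in>UNIV. \<Sum>j\<in>UNIV. qcnj (x $ i) * (p $ i ^ k * 1 * qcnj (p $ j) ^ k) * x $ j)" for k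
    unfolding h_def qcnj_sum sum_product by (simp add: mult.assoc)
  have gg: "qcnj (g k) * g k
      = (\<Sum>i\<in>UNIV. \<Sum>j\<in>UNIV. qcnj (x $ i) * (p $ i ^ k * (s $ i * qcnj (s $ j)) * qcnj (p $ j) ^ k) * x $ j)" for k
    unfolding g_def qcnj_sum sum_product by (simp add: mult.assoc)
  have "summable (\<lambda>k. qcnj (h k) * h k)"
    unfolding hh by (intro summable_sum summable_mult summable_mult2 pick_summable p)
  from bounded_linear.summable[OF bounded_linear_qre this]
  have h: "summable (\<lambda>k. (norm (h k))\<^sup>2)" by (simp only: qcnj_mult_self quat_of_real_sel)
  note contraction = schur_adjoint_contraction[OF c bound g h]
  define R where "R = (\<Sum>k. (norm (h k))\<^sup>2 - (norm (g k))\<^sup>2)"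
  have "(\<lambda>k. \<Sum>i\<in>UNIV. \<Sum>j\<in>UNIV. qcnj (x $ i) * (p $ i ^ k * (1 - s $ i * qcnj (s $ j)) * qcnj (p $ j) ^ k) * x $ j)
      sums (\<Sum>i\<in>UNIV. \<Sum>j\<in>UNIV. qcnj (x $ i) * pick_matrix p s $ i $ j * x $ j)"
    by (intro sums_sum sums_mult sums_mult2 pick_matrix_sums p)
  moreover have "(\<Sum>i\<in>UNIV. \<Sum>j\<in>UNIV. qcnj (x $ i) * (p $ i ^ k * (1 - s $ i * qcnj (s $ j)) * qcnj (p $ j) ^ k) * x $ j)
      = of_real ((norm (h k))\<^sup>2 - (norm (g k))\<^sup>2)" for k
    unfolding of_real_diff qcnj_mult_self[symmetric] hh gg
    by (simp only: right_diff_distrib left_diff_distrib sum_subtractf)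
  moreover have "(\<lambda>k. of_real ((norm (h k))\<^sup>2 - (norm (g k))\<^sup>2)) sums (of_real R :: quat)"
    unfolding R_def by (intro sums_of_real summable_sums summable_diff h contraction(1))
  ultimately have "(\<Sum>i\<in>UNIV. \<Sum>j\<in>UNIV. qcnj (x $ i) * pick_matrix p s $ i $ j * x $ j) = of_real R"
    by (simp add: sums_unique2)
  moreover have "0 \<le> R"
    unfolding R_def using contraction by (simp add: suminf_diff[OF h contraction(1), symmetric])
  ultimately show "(\<Sum>i\<in>UNIV. qcnj (x $ i) * (pick_matrix p s *v x) $ i) \<in> \<real>\<^sub>\<ge>\<^sub>0"
    unfolding hermitian_form_eq by simp
qed

text \<open>Both sides of the isometry behind the interpolation problem have this form, with \<open>v i = p i * b i\<close>,
\<open>t i = 1\<close> on one side and \<open>v i = b i\<close>, \<open>t i = s i\<close> on the other.\<close>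

definition row_combination :: "('n \<Rightarrow> 'n \<Rightarrow> quat) \<Rightarrow> ('n \<Rightarrow> quat) \<Rightarrow> quat ^ 'n \<Rightarrow> (quat ^ 'n) \<times> quat" where
  "row_combination v t d = ((\<chi> k. \<Sum>i\<in>UNIV. d $ i * v i k), \<Sum>i\<in>UNIV. d $ i * t i)"

lemma linear_row_combination: "linear (row_combination v t)"
  by (rule linearI)
     (simp_all add: row_combination_def vec_eq_iff distrib_right sum.distrib scaleR_sum_right)

lemma row_combination_vscale: "row_combination v t (vscale q d) = pscale q (row_combination v t d)"
  by (simp add: row_combination_def pscale_def vscale_def vec_eq_iff sum_distrib_left mult.assoc)

lemma row_combination_axis:
  fixes v :: "'n::finite \<Rightarrow> 'n \<Rightarrow> quat"
  shows "row_combination v t (axis i 1) = ((\<chi> k. v i k), t i)"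
proof -
  have "(\<Sum>j\<in>UNIV. axis i 1 $ j * y j) = y i" for y :: "'n \<Rightarrow> quat"
    by (simp add: axis_def if_distrib[of "\<lambda>a. a * _"] cong: if_cong)
  then show ?thesis by (simp add: row_combination_def vec_eq_iff)
qed

lemma norm_row_combination:
  "(norm (row_combination v t d))\<^sup>2
    = qre (\<Sum>i\<in>UNIV. \<Sum>j\<in>UNIV. d $ i * ((\<Sum>k\<in>UNIV. v i k * qcnj (v j k)) + t i * qcnj (t j)) * qcnj (d $ j))"
proof -
  have sq: "of_real ((norm (\<Sum>i\<in>UNIV. d $ i * y i))\<^sup>2)
      = (\<Sum>i\<in>UNIV. \<Sum>j\<in>UNIV. d $ i * (y i * qcnj (y j)) * qcnj (d $ j))" for y
    unfolding qcnj_mult_self(2)[symmetric] qcnj_sum sum_product by (simp add: mult.assoc)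
  have "of_real ((norm (row_combination v t d))\<^sup>2)
      = (\<Sum>k\<in>UNIV. of_real ((norm (\<Sum>i\<in>UNIV. d $ i * v i k))\<^sup>2)) + (of_real ((norm (\<Sum>i\<in>UNIV. d $ i * t i))\<^sup>2) :: quat)"
    by (simp add: row_combination_def norm_Pair norm_vec_def L2_set_def sum_nonneg)
  also have "\<dots> = (\<Sum>i\<in>UNIV. \<Sum>j\<in>UNIV. \<Sum>k\<in>UNIV. d $ i * (v i k * qcnj (v j k)) * qcnj (d $ j))
      + (\<Sum>i\<in>UNIV. \<Sum>j\<in>UNIV. d $ i * (t i * qcnj (t j)) * qcnj (d $ j))"
    unfolding sq by (subst sum.swap) (intro arg_cong2[of _ _ _ _ "(+)"] sum.cong refl sum.swap)
  also have "\<dots> = (\<Sum>i\<in>UNIV. \<Sum>j\<in>UNIV. d $ i * ((\<Sum>k\<in>UNIV. v i k * qcnj (v j k)) + t i * qcnj (t j)) * qcnj (d $ j))"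
    by (simp only: distrib_left distrib_right sum.distrib sum_distrib_left sum_distrib_right)
  finally show ?thesis by (metis quat_of_real_sel(1))
qed

text \<open>The lurking isometry: if \<open>P\<close> is the Gram matrix of vectors \<open>b i\<close>, the Stein equation says that
\<open>(p i * b i, 1) \<mapsto> (b i, s i)\<close> extends to an isometry of left submodules. Extended further to a contraction
\<open>U\<close>, it realises a Schur function, whose value at \<open>p i\<close> is \<open>s i\<close> because \<open>U (p i * b i, 1) = (b i, s i)\<close>.\<close>

lemma pick_psd_imp_schur_interpolant:
  fixes p s :: "quat ^ 'n"
  assumes p: "\<And>i. norm (p $ i) < 1" and psd: "quat_psd (pick_matrix p s)"
  shows "\<exists>S\<in>slice_schur_class. \<forall>i. S (p $ i) = s $ i"
proof -
  let ?P = "pick_matrix p s"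
  have "\<exists>b :: 'n \<Rightarrow> 'n \<Rightarrow> quat. \<forall>i\<in>UNIV. \<forall>j\<in>UNIV. ?P $ i $ j = (\<Sum>k\<in>UNIV. b i k * qcnj (b j k))"
  proof (rule quat_psd_gram[of UNIV "\<lambda>i j. ?P $ i $ j"])
    show "?P $ j $ i = qcnj (?P $ i $ j)" for i j by (rule pick_matrix_hermitian[OF p])
    fix x :: "'n \<Rightarrow> quat"
    have "(\<Sum>i\<in>UNIV. \<Sum>j\<in>UNIV. qcnj ((\<chi> i. x i) $ i) * ?P $ i $ j * (\<chi> i. x i) $ j) \<in> \<real>\<^sub>\<ge>\<^sub>0"
      using psd unfolding quat_psd_def hermitian_form_eq by blast
    then show "0 \<le> qre (\<Sum>i\<in>UNIV. \<Sum>j\<in>UNIV. qcnj (x i) * ?P $ i $ j * x j)"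
      by (auto simp: nonneg_Reals_def)
  qed simp
  then obtain b :: "'n \<Rightarrow> 'n \<Rightarrow> quat" where b: "\<And>i j. ?P $ i $ j = (\<Sum>k\<in>UNIV. b i k * qcnj (b j k))" by blast
  define f where "f = row_combination (\<lambda>i k. p $ i * b i k) (\<lambda>_. 1)"
  define g where "g = row_combination b (\<lambda>i. s $ i)"
  have gram: "(\<Sum>k\<in>UNIV. b i k * qcnj (b j k)) + s $ i * qcnj (s $ j)
      = (\<Sum>k\<in>UNIV. (p $ i * b i k) * qcnj (p $ j * b j k)) + 1 * qcnj 1" for i j
    using pick_matrix_stein[OF p, of s i j]
    by (simp add: b sum_distrib_left sum_distrib_right mult.assoc)
  have "(norm (g d))\<^sup>2 = (norm (f d))\<^sup>2" for d
    unfolding f_def g_def norm_row_combination gram ..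
  then have iso: "norm (g d) = norm (f d)" for d
    using power2_eq_imp_eq[OF _ norm_ge_zero norm_ge_zero] by blast
  obtain U where U: "linear U" "\<And>w. norm (U w) \<le> norm w" "\<And>d. U (f d) = g d"
      "\<And>q w. U (pscale q w) = pscale q (U w)"
    by (rule equivariant_contraction_extension[where f = f and g = g and \<alpha> = vscale and \<beta> = pscale
          and \<gamma> = pscale and adj = qcnj])
       (auto simp: f_def g_def linear_row_combination linear_pscale inner_pscale row_combination_vscale
         iso[unfolded f_def g_def])
  obtain S where S: "S \<in> slice_schur_class"
      "\<And>q v y. norm q < 1 \<Longrightarrow> U (vscale q v, 1) = (v, y) \<Longrightarrow> S q = y"
    using contractive_colligation_schur[OF U(1,2,4)] by blast
  have "S (p $ i) = s $ i" for i
  proof (rule S(2)[OF p])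
    show "U (vscale (p $ i) (\<chi> k. b i k), 1) = ((\<chi> k. b i k), s $ i)"
      using U(3)[of "axis i 1"] by (simp add: f_def g_def row_combination_axis vscale_def)
  qed
  then show ?thesis using S(1) by blast
qed

theorem theorem1p3:
  fixes p s :: "quat ^ 'n"
  assumes "\<And>i. p $ i \<in> ball 0 1"
    and "\<And>i j. i \<noteq> j \<Longrightarrow> p $ i \<noteq> p $ j"
  shows "(\<exists>S\<in>slice_schur_class. \<forall>i. S (p $ i) = s $ i) \<longleftrightarrow> quat_psd (pick_matrix p s)"
proof -
  have "norm (p $ i) < 1" for i using assms(1)[of i] by simp
  then show ?thesis
    using schur_interpolant_imp_pick_psd[of p _ s] pick_psd_imp_schur_interpolant[of p s] by blast
qed

end
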